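(* Let $R$ be a commutative ring with $1\ne0$, let $n>1$ and let $TR_n$ be the triangular group over $R$. Then: (1) $TR_n\cong\mathcal{L}^n_n\rtimes\cdots\rtimes\mathcal{L}^2_2\rtimes Aut_R(R[x])$; (2) $TR_n\cong(R_{[n-1]}\rtimes R_{[n-1]}^\times)\rtimes\cdots\rtimes(R[x_1]\rtimes R[x_1]^\times)\rtimes Aut_R(R[x])$. Moreover, $TR_n$ is solvable if and only if $Aut_R(R[x])$ is solvable. In particular, if $R$ is a domain, then $TR_n$ is solvable and $$TR_n\cong(R_{[n-1]}\rtimes R^\times)\rtimes\cdots\rtimes(R[x_1]\rtimes R^\times)\rtimes(R\rtimes R^\times).$$
   Context: $R_{[k]}=R[x_1,\ldots,x_k]$ and $R_{[k]}^\times$ is its group of multiplicative units. A polynomial $g\in R_{[k]}$ is unit-valued if $g(a)\in R^\times$ for all $a\in R^k$. Composition of $n$-tuples of polynomials: $\vec f\circ\vec g=(f_1(g_1,\ldots,g_n),\ldots,f_n(g_1,\ldots,g_n))$. For $n>1$, $\mathcal{MT}_n$ is the monoid under $\circ$ of all tuples $(f_1,f_2+x_2u_2,\ldots,f_n+x_nu_n)$ with $f_1\in R[x_1]$ inducing a bijection of $R$, $f_i,u_i\in R_{[i-1]}$, $u_i$ unit-valued ($2\le i\le n$). $TR_n$ is the group of units of $\mathcal{MT}_n$; $TR_1=Aut_R(R[x])$, the group under composition of polynomials $f\in R[x]$ that are invertible with respect to composition (equivalently, define $R$-automorphisms of $R[x]$). For $2\le k\le n$, $\mathcal{L}^n_k$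 is the subgroup of $TR_n$ of elements $(k:u;f)=(x_1,\ldots,x_{k-1},f+x_ku,x_{k+1},\ldots,x_n)$ with $f\in R_{[k-1]}$, $u\in R_{[k-1]}^\times$. Semi-direct products: $B\rtimes A$ is the set of pairs $(a,b)$, $a\in A$, $b\in B$, with product $(a,b)(c,d)=(ac,b\,\phi_a(d))$ (left action of $A$ on $B$ by automorphisms) or $(a,b)(c,d)=(ac,\phi_c(b)d)$ (right action). Convention: $A_1\rtimes A_2\rtimes A_3$ means $A_1\rtimes(A_2\rtimes A_3)$, and similarly for more factors. Actions: in $R_{[k-1]}\rtimes R_{[k-1]}^\times$ (additive group of the polynomial ring by its unit group; likewise $R_{[k-1]}\rtimes R^\times$ and $R\rtimes R^\times$) the units act by multiplication, $(u,f)(v,g)=(uv,f+ug)$, and this is identified with $\mathcal{L}^k_k$ via $(u,f)\leftrightarrow(k:u;f)$. In $\mathcal{L}^k_k\rtimes TR_{k-1}$, $TR_{k-1}$ acts from the right by substitution $(k:u;f)\mapsto(k:u(\vec h);f(\vec h))$, $\vec h\in TR_{k-1}$; in the iterated products the factor to the right of $\mathcal{L}^k_k$ is identified with $TR_{k-1}$. *)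

theory Defs
  imports
    "HOL-Library.Poly_Mapping"
    "HOL-Library.FuncSet"
    "HOL-Computational_Algebra.Polynomial"
    "HOL-Algebra.Algebraic_Closure_Type"
    "HOL-Algebra.Solvable_Groups"
    "HOL-Algebra.Weak_Morphisms"
begin

section \<open>Polynomials in several variables\<close>

text \<open>
  The coefficient ring \<open>R\<close> is a type of class \<^class>\<open>comm_ring_1\<close> (which includes \<open>1 \<noteq> 0\<close>).
  A polynomial maps monomials, i.e. finitely supported exponent vectors, to coefficients;
  the variables are \<open>x\<^sub>1, x\<^sub>2, \<dots>\<close> (index 0 is never used).
\<close>

type_synonym 'a mpoly = "(nat \<Rightarrow>\<^sub>0 nat) \<Rightarrow>\<^sub>0 'a"

definition mconst :: "'a::comm_ring_1 \<Rightarrow> 'a mpoly" where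
  "mconst c = Poly_Mapping.single 0 c"

definition mvar :: "nat \<Rightarrow> 'a::comm_ring_1 mpoly" where
  "mvar i = Poly_Mapping.single (Poly_Mapping.single i 1) 1"

text \<open>Send each coefficient \<open>c\<close> to \<open>\<phi> c\<close> and each variable \<open>x\<^sub>i\<close> to \<open>a i\<close>.\<close>

definition minsert ::
    "('a::comm_ring_1 \<Rightarrow> 'b::comm_ring_1) \<Rightarrow> (nat \<Rightarrow> 'b) \<Rightarrow> 'a mpoly \<Rightarrow> 'b" where
  "minsert \<phi> a p =
     (\<Sum>m\<in>Poly_Mapping.keys p. \<phi> (Poly_Mapping.lookup p m) *
        (\<Prod>i\<in>Poly_Mapping.keys m. a i ^ Poly_Mapping.lookup m i))"

definition meval :: "(nat \<Rightarrow> 'a::comm_ring_1) \<Rightarrow> 'a mpoly \<Rightarrow> 'a" where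
  "meval = minsert (\<lambda>c. c)"

definition msubst :: "(nat \<Rightarrow> 'a::comm_ring_1 mpoly) \<Rightarrow> 'a mpoly \<Rightarrow> 'a mpoly" where
  "msubst = minsert mconst"

text \<open>\<open>R\<^bsub>[k]\<^esub> = R[x\<^sub>1, \<dots>, x\<^sub>k]\<close>.\<close>

definition mpoly_ring :: "nat \<Rightarrow> 'a::comm_ring_1 mpoly ring" where
  "mpoly_ring k = ring_of_type_algebra
     \<lparr>carrier := {p. \<forall>m\<in>Poly_Mapping.keys p. Poly_Mapping.keys m \<subseteq> {1..k}}\<rparr>"

definition unit_valued :: "nat \<Rightarrow> 'a::comm_ring_1 mpoly \<Rightarrow> bool" where
  "unit_valued k g \<longleftrightarrow>
     g \<in> carrier (mpoly_ring k) \<and> (\<forall>a \<in> {1..k} \<rightarrow>\<^sub>E UNIV. meval a g dvd 1)"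


section \<open>The triangular groups\<close>

text \<open>An \<open>n\<close>-tuple is an extensional function on \<open>{1..n}\<close>.\<close>

type_synonym 'a mtuple = "nat \<Rightarrow> 'a mpoly"

definition tuple_comp :: "nat \<Rightarrow> 'a::comm_ring_1 mtuple \<Rightarrow> 'a mtuple \<Rightarrow> 'a mtuple" where
  "tuple_comp n f g = (\<lambda>i\<in>{1..n}. msubst g (f i))"

definition MT :: "nat \<Rightarrow> 'a::comm_ring_1 mtuple monoid" where
  "MT n = \<lparr>carrier = {F \<in> extensional {1..n}.
              F 1 \<in> carrier (mpoly_ring 1) \<and> bij (\<lambda>a::'a. meval (\<lambda>_. a) (F 1)) \<and>
              (\<forall>i\<in>{2..n}. \<exists>f\<in>carrier (mpoly_ring (i - 1)). \<exists>u\<in>carrier (mpoly_ring (i - 1)).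
                 unit_valued (i - 1) u \<and> F i = f + mvar i * u)},
           monoid.mult = tuple_comp n,
           one = (\<lambda>i\<in>{1..n}. mvar i)\<rparr>"

text \<open>Intended for \<open>n > 1\<close>; the role of \<open>TR\<^sub>1\<close> is played by \<open>Aut_Rx\<close> below.\<close>

definition TR :: "nat \<Rightarrow> 'a::comm_ring_1 mtuple monoid" where
  "TR n = units_of (MT n)"

definition Aut_Rx :: "'a::comm_ring_1 poly monoid" where
  "Aut_Rx = units_of \<lparr>carrier = UNIV, monoid.mult = pcompose, one = [:0, 1:]\<rparr>"

definition poly_to_mpoly :: "'a::comm_ring_1 poly \<Rightarrow> 'a mpoly" where
  "poly_to_mpoly p = poly (map_poly mconst p) (mvar 1)"

text \<open>The element \<open>(k:u;f)\<close>.\<close>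

definition lin_elem ::
    "nat \<Rightarrow> nat \<Rightarrow> 'a::comm_ring_1 mpoly \<Rightarrow> 'a mpoly \<Rightarrow> 'a mtuple" where
  "lin_elem n k u f = (\<lambda>i\<in>{1..n}. if i = k then f + mvar k * u else mvar i)"

definition Lin :: "nat \<Rightarrow> nat \<Rightarrow> 'a::comm_ring_1 mtuple monoid" where
  "Lin n k = (TR n)\<lparr>carrier :=
     {lin_elem n k u f | u f. u \<in> Units (mpoly_ring (k - 1)) \<and> f \<in> carrier (mpoly_ring (k - 1))}\<rparr>"


section \<open>Semi-direct products\<close>

text \<open>
  Both are \<open>B \<rtimes> A\<close>, with elements written as pairs \<open>(a, b)\<close>; the action \<open>\<phi> a\<close> on \<open>B\<close> is a
  left action in the first case and a right action in the second.
\<close>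

definition semidirect_left ::
    "'a monoid \<Rightarrow> 'b monoid \<Rightarrow> ('a \<Rightarrow> 'b \<Rightarrow> 'b) \<Rightarrow> ('a \<times> 'b) monoid" where
  "semidirect_left A B \<phi> =
     \<lparr>carrier = carrier A \<times> carrier B,
      monoid.mult = (\<lambda>(a, b) (c, d). (a \<otimes>\<^bsub>A\<^esub> c, b \<otimes>\<^bsub>B\<^esub> \<phi> a d)),
      one = (\<one>\<^bsub>A\<^esub>, \<one>\<^bsub>B\<^esub>)\<rparr>"

definition semidirect_right ::
    "'a monoid \<Rightarrow> 'b monoid \<Rightarrow> ('a \<Rightarrow> 'b \<Rightarrow> 'b) \<Rightarrow> ('a \<times> 'b) monoid" where
  "semidirect_right A B \<phi> =
     \<lparr>carrier = carrier A \<times> carrier B,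
      monoid.mult = (\<lambda>(a, b) (c, d). (a \<otimes>\<^bsub>A\<^esub> c, \<phi> c b \<otimes>\<^bsub>B\<^esub> d)),
      one = (\<one>\<^bsub>A\<^esub>, \<one>\<^bsub>B\<^esub>)\<rparr>"

text \<open>
  The number of factors of an iterated product is not fixed, so the nested pairs
  \<open>((\<dots>(a, b\<^sub>2), \<dots>), b\<^sub>n)\<close> live in a recursive type; \<open>NPair t b\<close> stands for the pair \<open>(t, b)\<close>.
\<close>

datatype ('a, 'b) nested = NBase 'a | NPair "('a, 'b) nested" 'b

text \<open>
  \<open>iter_semidirect A B act n\<close> is \<open>B n \<rtimes> (B (n-1) \<rtimes> (\<dots> \<rtimes> (B 2 \<rtimes> A)))\<close>, where the elements of the
  factor to the right of \<open>B k\<close> act on \<open>B k\<close> from the right by \<open>act k\<close>. For \<open>n \<le> 1\<close> it is \<open>A\<close>.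
\<close>

primrec iter_semidirect ::
    "'a monoid \<Rightarrow> (nat \<Rightarrow> 'b monoid) \<Rightarrow> (nat \<Rightarrow> ('a, 'b) nested \<Rightarrow> 'b \<Rightarrow> 'b) \<Rightarrow> nat \<Rightarrow>
     ('a, 'b) nested monoid" where
  "iter_semidirect A B act 0 = image_group NBase A"
| "iter_semidirect A B act (Suc k) =
     (if k = 0 then image_group NBase A
      else image_group (\<lambda>(t, b). NPair t b)
             (semidirect_right (iter_semidirect A B act k) (B (Suc k)) (act (Suc k))))"

text \<open>
  Identification of elements of an iterated product with elements of the triangular group:
  \<open>base a\<close> is the first component, and the pair \<open>(h, b)\<close> with \<open>h \<in> TR\<^bsub>k-1\<^esub>\<close> and \<open>b\<close> representing
  \<open>(k:u;f)\<close> becomes \<open>h \<circ> (k:u;f) = (h\<^sub>1, \<dots>, h\<^bsub>k-1\<^esub>, f + x\<^sub>k u)\<close>. Here \<open>coord k b\<close> is the pair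
  \<open>(u, f)\<close>. The order \<open>h \<circ> (k:u;f)\<close> is the one compatible with a right action of \<open>TR\<^bsub>k-1\<^esub>\<close>.
\<close>

primrec level :: "('a, 'b) nested \<Rightarrow> nat" where
  "level (NBase a) = 1"
| "level (NPair t b) = Suc (level t)"

primrec nested_tuple ::
    "('b \<Rightarrow> 'a::comm_ring_1 mpoly) \<Rightarrow> (nat \<Rightarrow> 'c \<Rightarrow> 'a mpoly \<times> 'a mpoly) \<Rightarrow> ('b, 'c) nested \<Rightarrow>
     'a mtuple" where
  "nested_tuple base coord (NBase a) = (\<lambda>i\<in>{1..1}. base a)"
| "nested_tuple base coord (NPair t b) =
     (let k = Suc (level t); (u, f) = coord k b
      in (nested_tuple base coord t)(k := f + mvar k * u))"


section \<open>The three decompositions\<close>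

text \<open>First form: \<open>\<L>\<^sup>n\<^sub>n \<rtimes> \<dots> \<rtimes> \<L>\<^sup>2\<^sub>2 \<rtimes> Aut\<^sub>R(R[x])\<close>.\<close>

definition Lin_coord :: "nat \<Rightarrow> 'a::comm_ring_1 mtuple \<Rightarrow> 'a mpoly \<times> 'a mpoly" where
  "Lin_coord k =
     the_inv_into (Units (mpoly_ring (k - 1)) \<times> carrier (mpoly_ring (k - 1)))
       (\<lambda>(u, f). lin_elem k k u f)"

definition Lin_act ::
    "nat \<Rightarrow> ('a::comm_ring_1 poly, 'a mtuple) nested \<Rightarrow> 'a mtuple \<Rightarrow> 'a mtuple" where
  "Lin_act k t l =
     (let h = nested_tuple poly_to_mpoly Lin_coord t; (u, f) = Lin_coord k l
      in lin_elem k k (msubst h u) (msubst h f))"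

definition Lin_product ::
    "nat \<Rightarrow> ('a::comm_ring_1 poly, 'a mtuple) nested monoid" where
  "Lin_product = iter_semidirect Aut_Rx (\<lambda>k. Lin k k) Lin_act"

text \<open>Second form:
  \<open>(R\<^bsub>[n-1]\<^esub> \<rtimes> R\<^bsub>[n-1]\<^esub>\<^sup>\<times>) \<rtimes> \<dots> \<rtimes> (R[x\<^sub>1] \<rtimes> R[x\<^sub>1]\<^sup>\<times>) \<rtimes> Aut\<^sub>R(R[x])\<close>.\<close>

definition Aff_group :: "nat \<Rightarrow> ('a::comm_ring_1 mpoly \<times> 'a mpoly) monoid" where
  "Aff_group k =
     semidirect_left (units_of (mpoly_ring (k - 1))) (add_monoid (mpoly_ring (k - 1))) (*)"

definition Aff_act ::
    "nat \<Rightarrow> ('a::comm_ring_1 poly, 'a mpoly \<times> 'a mpoly) nested \<Rightarrow>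
     'a mpoly \<times> 'a mpoly \<Rightarrow> 'a mpoly \<times> 'a mpoly" where
  "Aff_act k t = (\<lambda>(u, f). let h = nested_tuple poly_to_mpoly (\<lambda>_ b. b) t
                           in (msubst h u, msubst h f))"

definition Aff_product ::
    "nat \<Rightarrow> ('a::comm_ring_1 poly, 'a mpoly \<times> 'a mpoly) nested monoid" where
  "Aff_product = iter_semidirect Aut_Rx Aff_group Aff_act"

text \<open>Third form, for domains:
  \<open>(R\<^bsub>[n-1]\<^esub> \<rtimes> R\<^sup>\<times>) \<rtimes> \<dots> \<rtimes> (R[x\<^sub>1] \<rtimes> R\<^sup>\<times>) \<rtimes> (R \<rtimes> R\<^sup>\<times>)\<close>.
  In the last factor \<open>(u, f)\<close> is identified with the polynomial \<open>f + u x\<^sub>1\<close>. Substitution fixes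
  the constants in \<open>R\<^sup>\<times>\<close>.\<close>

definition Aff_base :: "('a::comm_ring_1 \<times> 'a) monoid" where
  "Aff_base = semidirect_left (units_of ring_of_type_algebra) (add_monoid ring_of_type_algebra) (*)"

definition Aff_const_group :: "nat \<Rightarrow> ('a::comm_ring_1 \<times> 'a mpoly) monoid" where
  "Aff_const_group k =
     semidirect_left (units_of ring_of_type_algebra) (add_monoid (mpoly_ring (k - 1)))
       (\<lambda>u f. mconst u * f)"

definition Aff_const_act ::
    "nat \<Rightarrow> ('a::comm_ring_1 \<times> 'a, 'a \<times> 'a mpoly) nested \<Rightarrow> 'a \<times> 'a mpoly \<Rightarrow> 'a \<times> 'a mpoly" where
  "Aff_const_act k t =
     (\<lambda>(u, f). let h = nested_tuple (\<lambda>(v, g). mconst g + mvar 1 * mconst v)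
                                    (\<lambda>_ (v, g). (mconst v, g)) t
               in (u, msubst h f))"

definition Aff_const_product ::
    "nat \<Rightarrow> ('a::comm_ring_1 \<times> 'a, 'a \<times> 'a mpoly) nested monoid" where
  "Aff_const_product = iter_semidirect Aff_base Aff_const_group Aff_const_act"

end

theory Submission
  imports Defs
begin

text \<open>
  Splitting off the last coordinate writes every \<open>F \<in> TR\<^bsub>k+1\<^esub>\<close> as \<open>F' \<circ> (k+1:u;f)\<close> with
  \<open>F' \<in> TR\<^sub>k\<close>, and the composite of \<open>(F', f + x u)\<close> and \<open>(G', g + x v)\<close>, where \<open>x = x\<^bsub>k+1\<^esub>\<close>, has last
  coordinate \<open>(f(G') + g u(G')) + x u(G') v\<close>. So \<open>TR\<^bsub>k+1\<^esub>\<close> is the semidirect product of \<open>TR\<^sub>k\<close>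
  and the affine group \<open>R\<^bsub>[k]\<^esub> \<rtimes> R\<^bsub>[k]\<^esub>\<^sup>\<times>\<close>, and all three decompositions follow by induction from
  \<open>TR\<^sub>1 = Aut\<^sub>R(R[x])\<close>. As the affine group is metabelian, each step preserves solvability in both
  directions. Over a domain, comparing leading terms shows that the units of \<open>R\<^bsub>[k]\<^esub>\<close> are constants
  and that the elements of \<open>Aut\<^sub>R(R[x])\<close> have degree 1.
\<close>

section \<open>Evaluation and substitution\<close>

lemma poly_mapping_single_add_induct:
  fixes p :: "'b \<Rightarrow>\<^sub>0 'c::comm_monoid_add"
  assumes "\<And>m c. P (Poly_Mapping.single m c)" "\<And>p q. P p \<Longrightarrow> P q \<Longrightarrow> P (p + q)"
  shows "P p"
proof -
  have P0: "P 0" using assms(1)[of undefined 0] by simp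
  have "p = (\<Sum>m\<in>Poly_Mapping.keys p. Poly_Mapping.single m (Poly_Mapping.lookup p m))"
    by (rule poly_mapping_eqI) (auto simp: lookup_sum lookup_single when_def in_keys_iff)
  moreover have "P (\<Sum>m\<in>S. Poly_Mapping.single m (Poly_Mapping.lookup p m))" if "finite S" for S
    using that by induction (auto simp: P0 intro: assms)
  ultimately show ?thesis by (metis finite_keys)
qed

definition mon_value :: "(nat \<Rightarrow> 'b::comm_ring_1) \<Rightarrow> (nat \<Rightarrow>\<^sub>0 nat) \<Rightarrow> 'b" where
  "mon_value a m = (\<Prod>i\<in>Poly_Mapping.keys m. a i ^ Poly_Mapping.lookup m i)"

lemma mon_value_superset:
  assumes "finite S" "Poly_Mapping.keys m \<subseteq> S"
  shows "mon_value a m = (\<Prod>i\<in>S. a i ^ Poly_Mapping.lookup m i)"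
  unfolding mon_value_def using assms
  by (intro prod.mono_neutral_left) (auto simp: in_keys_iff)

lemma mon_value_add: "mon_value a (m + m') = mon_value a m * mon_value a m'"
proof -
  let ?S = "Poly_Mapping.keys m \<union> Poly_Mapping.keys m'"
  have "mon_value a (m + m') = (\<Prod>i\<in>?S. a i ^ Poly_Mapping.lookup (m + m') i)"
    by (intro mon_value_superset) (simp_all add: Poly_Mapping.keys_add)
  also have "\<dots> = mon_value a m * mon_value a m'"
    by (subst (1 2) mon_value_superset[of ?S]) (auto simp: lookup_add power_add prod.distrib)
  finally show ?thesis .
qed

lemma mon_value_zero [simp]: "mon_value a 0 = 1"
  by (simp add: mon_value_def)

lemma mon_value_single [simp]: "mon_value a (Poly_Mapping.single i e) = a i ^ e"
  by (simp add: mon_value_def)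

lemma mvar_power: "mvar i ^ e = Poly_Mapping.single (Poly_Mapping.single i e) (1::'a::comm_ring_1)"
  by (induction e) (simp_all add: mvar_def mult_single single_add[symmetric])

lemma mon_value_mvar: "mon_value mvar m = Poly_Mapping.single m (1::'a::comm_ring_1)"
  by (induction m rule: poly_mapping_single_add_induct)
     (simp_all add: mvar_power mon_value_add mult_single)

locale coeff_hom =
  fixes \<phi> :: "'a::comm_ring_1 \<Rightarrow> 'b::comm_ring_1"
  assumes hom_add: "\<phi> (a + b) = \<phi> a + \<phi> b"
    and hom_mult: "\<phi> (a * b) = \<phi> a * \<phi> b"
    and hom_one: "\<phi> 1 = 1"
begin

lemma hom_zero: "\<phi> 0 = 0"
  using hom_add[of 0 0] by simp

lemma minsert_superset:
  assumes "finite S" "Poly_Mapping.keys p \<subseteq> S"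
  shows "minsert \<phi> a p = (\<Sum>m\<in>S. \<phi> (Poly_Mapping.lookup p m) * mon_value a m)"
  unfolding minsert_def mon_value_def[symmetric] using assms
  by (intro sum.mono_neutral_left) (auto simp: in_keys_iff hom_zero)

lemma minsert_single: "minsert \<phi> a (Poly_Mapping.single m c) = \<phi> c * mon_value a m"
  by (subst minsert_superset[of "{m}"]) (auto split: if_splits)

lemma minsert_add: "minsert \<phi> a (p + q) = minsert \<phi> a p + minsert \<phi> a q"
proof -
  let ?S = "Poly_Mapping.keys p \<union> Poly_Mapping.keys q"
  have "minsert \<phi> a (p + q) = (\<Sum>m\<in>?S. \<phi> (Poly_Mapping.lookup (p + q) m) * mon_value a m)"
    by (intro minsert_superset) (simp_all add: Poly_Mapping.keys_add)
  also have "\<dots> = minsert \<phi> a p + minsert \<phi> a q"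
    by (subst (1 2) minsert_superset[of ?S]) (auto simp: lookup_add hom_add algebra_simps sum.distrib)
  finally show ?thesis .
qed

lemma minsert_mult: "minsert \<phi> a (p * q) = minsert \<phi> a p * minsert \<phi> a q"
proof (induction p rule: poly_mapping_single_add_induct)
  case (1 m c)
  show ?case
    by (induction q rule: poly_mapping_single_add_induct)
       (simp_all add: mult_single minsert_single minsert_add hom_mult mon_value_add algebra_simps)
qed (simp add: minsert_add algebra_simps)

lemma minsert_mconst: "minsert \<phi> a (mconst c) = \<phi> c"
  by (simp add: mconst_def minsert_single)

lemma minsert_mvar: "minsert \<phi> a (mvar i) = a i"
  by (simp add: mvar_def minsert_single hom_one)

end

lemma mconst_add: "mconst (a + b) = mconst a + mconst b"
  by (simp add: mconst_def single_add)

lemma mconst_mult: "mconst (a * b) = mconst a * mconst b"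
  by (simp add: mconst_def mult_single)

lemma mconst_0 [simp]: "mconst 0 = 0" and mconst_1 [simp]: "mconst 1 = 1"
  by (simp_all add: mconst_def)

interpretation mconst_hom: coeff_hom mconst
  by unfold_locales (simp_all add: mconst_add mconst_mult)

interpretation id_hom: coeff_hom "\<lambda>c. c"
  by unfold_locales simp_all

interpretation pconst_hom: coeff_hom "\<lambda>c. [:c:]"
  by unfold_locales simp_all

lemma msubst_0 [simp]: "msubst g 0 = 0"
  and msubst_1 [simp]: "msubst g 1 = 1"
  and msubst_mconst [simp]: "msubst g (mconst c) = mconst c"
  and msubst_mvar [simp]: "msubst g (mvar i) = g i"
  and msubst_add [simp]: "msubst g (p + q) = msubst g p + msubst g q"
  and msubst_mult [simp]: "msubst g (p * q) = msubst g p * msubst g q"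
  using mconst_hom.minsert_mconst[of g 0] mconst_hom.minsert_mconst[of g 1]
  by (simp_all add: msubst_def mconst_hom.minsert_mconst mconst_hom.minsert_mvar
      mconst_hom.minsert_add mconst_hom.minsert_mult)

lemma msubst_uminus [simp]: "msubst g (- p) = - msubst g p"
  using msubst_add[of g p "- p"] by (simp del: msubst_add add: eq_neg_iff_add_eq_0 add.commute)

lemma single_eq_mconst_mult: "Poly_Mapping.single m c = mconst c * mon_value mvar m"
  by (simp add: mon_value_mvar mconst_def mult_single)

lemma carrier_mpoly_ring:
  "p \<in> carrier (mpoly_ring k) \<longleftrightarrow> (\<forall>m\<in>Poly_Mapping.keys p. Poly_Mapping.keys m \<subseteq> {1..k})"
  by (simp add: mpoly_ring_def)

lemma mpoly_ring_simps [simp]: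
  "monoid.mult (mpoly_ring k) = (*)" "ring.add (mpoly_ring k) = (+)"
  "one (mpoly_ring k) = 1" "zero (mpoly_ring k) = 0"
  by (simp_all add: mpoly_ring_def ring_of_type_algebra_def)

lemma mpoly_add_closed:
  "p \<in> carrier (mpoly_ring k) \<Longrightarrow> q \<in> carrier (mpoly_ring k) \<Longrightarrow> p + q \<in> carrier (mpoly_ring k)"
  using Poly_Mapping.keys_add[of p q] by (auto simp: carrier_mpoly_ring)

lemma mpoly_mult_closed:
  assumes "p \<in> carrier (mpoly_ring k)" "q \<in> carrier (mpoly_ring k)"
  shows "p * q \<in> carrier (mpoly_ring k)"
  unfolding carrier_mpoly_ring
proof
  fix m assume "m \<in> Poly_Mapping.keys (p * q)"
  then obtain a b where "m = a + b" "a \<in> Poly_Mapping.keys p" "b \<in> Poly_Mapping.keys q"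
    using keys_mult[of p q] by auto
  then show "Poly_Mapping.keys m \<subseteq> {1..k}"
    using assms Poly_Mapping.keys_add[of a b] unfolding carrier_mpoly_ring by blast
qed

lemma mconst_closed: "mconst c \<in> carrier (mpoly_ring k)"
  by (simp add: carrier_mpoly_ring mconst_def)

lemma mvar_closed: "1 \<le> i \<Longrightarrow> i \<le> k \<Longrightarrow> mvar i \<in> carrier (mpoly_ring k)"
  by (simp add: carrier_mpoly_ring mvar_def)

lemma mpoly_zero_closed: "0 \<in> carrier (mpoly_ring k)"
  and mpoly_one_closed: "1 \<in> carrier (mpoly_ring k)"
  using mconst_closed[of 0] mconst_closed[of 1] by auto

lemma mpoly_uminus_closed: "p \<in> carrier (mpoly_ring k) \<Longrightarrow> - p \<in> carrier (mpoly_ring k)"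
  by (auto simp: carrier_mpoly_ring in_keys_iff)

lemmas mpoly_closed = mpoly_add_closed mpoly_mult_closed mconst_closed mpoly_zero_closed
  mpoly_one_closed mpoly_uminus_closed mvar_closed

lemma mpoly_ring_mono: "p \<in> carrier (mpoly_ring k) \<Longrightarrow> k \<le> l \<Longrightarrow> p \<in> carrier (mpoly_ring l)"
  by (fastforce simp: carrier_mpoly_ring)

lemma mpoly_ring_induct [consumes 1, case_names const var add mult]:
  assumes p: "p \<in> carrier (mpoly_ring k)"
    and const: "\<And>c. P (mconst c)"
    and var: "\<And>i. 1 \<le> i \<Longrightarrow> i \<le> k \<Longrightarrow> P (mvar i)"
    and add: "\<And>p q. P p \<Longrightarrow> P q \<Longrightarrow> P (p + q)"
    and mult: "\<And>p q. P p \<Longrightarrow> P q \<Longrightarrow> P (p * q)"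
  shows "P p"
proof -
  have P0: "P 0" and P1: "P 1" using const[of 0] const[of 1] by auto
  have pow: "P (q ^ e)" if "P q" for q e using that by (induction e) (auto simp: P1 mult)
  have mon: "P (mon_value mvar m)" if "Poly_Mapping.keys m \<subseteq> {1..k}" for m
  proof -
    have "P (\<Prod>i\<in>S. mvar i ^ Poly_Mapping.lookup m i)" if "finite S" "S \<subseteq> {1..k}" for S
      using that by induction (auto simp: P1 intro!: mult pow var)
    with that show ?thesis unfolding mon_value_def by simp
  qed
  have "p = (\<Sum>m\<in>Poly_Mapping.keys p. Poly_Mapping.single m (Poly_Mapping.lookup p m))"
    by (rule poly_mapping_eqI) (auto simp: lookup_sum lookup_single when_def in_keys_iff)
  moreover have "P (\<Sum>m\<in>S. Poly_Mapping.single m (Poly_Mapping.lookup p m))"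
    if "finite S" "S \<subseteq> Poly_Mapping.keys p" for S
    using that
  proof induction
    case (insert m S)
    have "Poly_Mapping.keys m \<subseteq> {1..k}"
      using insert.prems p by (auto simp only: carrier_mpoly_ring insert_subset)
    then show ?case
      using insert by (simp add: single_eq_mconst_mult add mult const mon)
  qed (simp add: P0)
  ultimately show ?thesis by (metis finite_keys order_refl)
qed

lemma msubst_cong:
  assumes "p \<in> carrier (mpoly_ring k)" "\<And>i. 1 \<le> i \<Longrightarrow> i \<le> k \<Longrightarrow> g i = h i"
  shows "msubst g p = msubst h p"
  using assms(1) by (induction rule: mpoly_ring_induct) (auto simp: assms(2))

lemma msubst_closed:
  assumes "p \<in> carrier (mpoly_ring k)"
    "\<And>i. 1 \<le> i \<Longrightarrow> i \<le> k \<Longrightarrow> g i \<in> carrier (mpoly_ring l)"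
  shows "msubst g p \<in> carrier (mpoly_ring l)"
  using assms(1) by (induction rule: mpoly_ring_induct) (auto simp: mpoly_closed assms(2))

lemma msubst_id:
  assumes "p \<in> carrier (mpoly_ring k)" "\<And>i. 1 \<le> i \<Longrightarrow> i \<le> k \<Longrightarrow> g i = mvar i"
  shows "msubst g p = p"
  using assms(1) by (induction rule: mpoly_ring_induct) (auto simp: assms(2))

lemma msubst_msubst:
  assumes "p \<in> carrier (mpoly_ring k)"
    "\<And>i. 1 \<le> i \<Longrightarrow> i \<le> k \<Longrightarrow> msubst g (h i) = gh i"
  shows "msubst g (msubst h p) = msubst gh p"
  using assms(1) by (induction rule: mpoly_ring_induct) (auto simp: assms(2))

lemma meval_simps [simp]:
  "meval a 0 = 0" "meval a 1 = 1" "meval a (mconst c) = c" "meval a (mvar i) = a i"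
  "meval a (p + q) = meval a p + meval a q" "meval a (p * q) = meval a p * meval a q"
  using id_hom.minsert_mconst[of a 0] id_hom.minsert_mconst[of a 1]
  by (simp_all add: meval_def id_hom.minsert_mconst id_hom.minsert_mvar
      id_hom.minsert_add id_hom.minsert_mult)

lemma meval_msubst:
  assumes "p \<in> carrier (mpoly_ring k)"
    "\<And>i. 1 \<le> i \<Longrightarrow> i \<le> k \<Longrightarrow> meval a (h i) = b i"
  shows "meval a (msubst h p) = meval b p"
  using assms(1) by (induction rule: mpoly_ring_induct) (auto simp: assms(2))

lemma cring_mpoly_ring: "cring (mpoly_ring k :: 'a::comm_ring_1 mpoly ring)"
proof -
  have "\<exists>y\<in>carrier (mpoly_ring k). y + x = 0" if "x \<in> carrier (mpoly_ring k)" for x :: "'a mpoly"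
    using that by (intro bexI[of _ "- x"]) (auto simp: mpoly_closed)
  then show ?thesis
    by (intro cringI abelian_groupI comm_monoidI) (auto simp: mpoly_closed algebra_simps)
qed

lemma Units_mpoly_ring:
  "u \<in> Units (mpoly_ring k) \<longleftrightarrow>
     u \<in> carrier (mpoly_ring k) \<and> (\<exists>v\<in>carrier (mpoly_ring k). u * v = 1)"
  by (auto simp: Units_def mult.commute)

lemma Units_mpoly_ringI:
  "u \<in> carrier (mpoly_ring k) \<Longrightarrow> v \<in> carrier (mpoly_ring k) \<Longrightarrow> u * v = 1 \<Longrightarrow> u \<in> Units (mpoly_ring k)"
  by (auto simp: Units_mpoly_ring)

lemma Units_mult_closed:
  assumes "u \<in> Units (mpoly_ring k)" "v \<in> Units (mpoly_ring k)"
  shows "u * v \<in> Units (mpoly_ring k)"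
  using monoid.Units_m_closed[OF ring.is_monoid[OF cring.axioms(1)[OF cring_mpoly_ring]] assms]
  by simp

lemma Units_msubst:
  assumes "u \<in> Units (mpoly_ring k)"
    "\<And>i. 1 \<le> i \<Longrightarrow> i \<le> k \<Longrightarrow> g i \<in> carrier (mpoly_ring l)"
  shows "msubst g u \<in> Units (mpoly_ring l)"
proof -
  obtain v where u: "u \<in> carrier (mpoly_ring k)" and v: "v \<in> carrier (mpoly_ring k)" "u * v = 1"
    using assms by (auto simp: Units_mpoly_ring)
  have "msubst g u * msubst g v = 1" using v(2) by (metis msubst_1 msubst_mult)
  then show ?thesis using msubst_closed[OF _ assms(2)] u v by (intro Units_mpoly_ringI[of _ _ "msubst g v"])
qed

lemma affine_eq_iff:
  fixes f :: "'a::comm_ring_1 mpoly"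
  assumes "f \<in> carrier (mpoly_ring k)" "u \<in> carrier (mpoly_ring k)"
    "f' \<in> carrier (mpoly_ring k)" "u' \<in> carrier (mpoly_ring k)" "k < l"
  shows "f + mvar l * u = f' + mvar l * u' \<longleftrightarrow> f = f' \<and> u = u'"
proof
  assume eq: "f + mvar l * u = f' + mvar l * u'"
  have "msubst (mvar(l := c)) p = p" if "p \<in> carrier (mpoly_ring k)"
    for p c :: "'a mpoly"
    using that \<open>k < l\<close> by (intro msubst_id) auto
  then have sub: "f + c * u = f' + c * u'" for c
    using arg_cong[OF eq, of "msubst (mvar(l := c))"] assms by simp
  show "f = f' \<and> u = u'" using sub[of 0] sub[of 1] by simp
qed simp

section \<open>The units of the triangular monoid\<close>

definition comp_units :: "'a::comm_ring_1 mpoly set" where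
  "comp_units = {P \<in> carrier (mpoly_ring 1). \<exists>Q\<in>carrier (mpoly_ring 1).
     msubst (\<lambda>_. Q) P = mvar 1 \<and> msubst (\<lambda>_. P) Q = mvar 1}"

definition Tri :: "nat \<Rightarrow> 'a::comm_ring_1 mtuple set" where
  "Tri n = {F \<in> extensional {1..n}. F 1 \<in> comp_units \<and>
     (\<forall>i\<in>{2..n}. \<exists>f\<in>carrier (mpoly_ring (i - 1)). \<exists>u\<in>Units (mpoly_ring (i - 1)).
        F i = f + mvar i * u)}"

lemma Units_imp_carrier: "u \<in> Units (mpoly_ring k) \<Longrightarrow> u \<in> carrier (mpoly_ring k)"
  by (simp add: Units_mpoly_ring)

lemma comp_units_closed: "P \<in> comp_units \<Longrightarrow> P \<in> carrier (mpoly_ring 1)"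
  by (simp add: comp_units_def)

lemma comp_units_mvar: "mvar 1 \<in> comp_units"
  by (auto simp: comp_units_def mpoly_closed intro!: bexI[of _ "mvar 1"])

lemma comp_units_comp:
  assumes "P \<in> comp_units" "Q \<in> comp_units"
  shows "msubst (\<lambda>_. Q) P \<in> comp_units"
proof -
  obtain P' Q' where P': "P' \<in> carrier (mpoly_ring 1)" "msubst (\<lambda>_. P') P = mvar 1" "msubst (\<lambda>_. P) P' = mvar 1"
    and Q': "Q' \<in> carrier (mpoly_ring 1)" "msubst (\<lambda>_. Q') Q = mvar 1" "msubst (\<lambda>_. Q) Q' = mvar 1"
    using assms by (auto simp: comp_units_def)
  have P: "P \<in> carrier (mpoly_ring 1)" and Q: "Q \<in> carrier (mpoly_ring 1)"
    using assms by (auto simp: comp_units_def)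
  let ?PQ = "msubst (\<lambda>_. Q) P" and ?QP' = "msubst (\<lambda>_. P') Q'"
  have "msubst (\<lambda>_. ?QP') Q = msubst (\<lambda>_. P') (msubst (\<lambda>_. Q') Q)"
    by (rule msubst_msubst[OF Q refl, symmetric])
  then have "msubst (\<lambda>_. ?QP') ?PQ = mvar 1"
    by (subst msubst_msubst[OF P refl]) (simp add: P'(2) Q'(2))
  moreover have "msubst (\<lambda>_. ?PQ) P' = msubst (\<lambda>_. Q) (msubst (\<lambda>_. P) P')"
    by (rule msubst_msubst[OF P'(1) refl, symmetric])
  then have "msubst (\<lambda>_. ?PQ) ?QP' = mvar 1"
    by (subst msubst_msubst[OF Q'(1) refl]) (simp add: P'(3) Q'(3))
  moreover have "?PQ \<in> carrier (mpoly_ring 1)" "?QP' \<in> carrier (mpoly_ring 1)"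
    by (rule msubst_closed[OF P Q], rule msubst_closed[OF Q'(1) P'(1)])
  ultimately show ?thesis unfolding comp_units_def by blast
qed

lemma Tri_1: "Tri 1 = (\<lambda>P::'a::comm_ring_1 mpoly. \<lambda>i\<in>{1..1}. P) ` comp_units"
    (is "_ = ?T")
proof
  show "Tri 1 \<subseteq> ?T"
  proof
    fix F :: "'a mtuple" assume F: "F \<in> Tri 1"
    then have "F = (\<lambda>i\<in>{1..1}. F 1)" by (auto simp: Tri_def extensional_def fun_eq_iff)
    with F show "F \<in> ?T" by (auto simp: Tri_def)
  qed
qed (auto simp: Tri_def)

lemma Tri_Suc:
  assumes "k \<ge> 1"
  shows "Tri (Suc k) = {F(Suc k := f + mvar (Suc k) * u) | F f u.
    F \<in> Tri k \<and> f \<in> carrier (mpoly_ring k) \<and> u \<in> Units (mpoly_ring k)}" (is "_ = ?T")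
proof
  show "Tri (Suc k) \<subseteq> ?T"
  proof
    fix F :: "'a mtuple" assume F: "F \<in> Tri (Suc k)"
    then obtain f u where fu: "f \<in> carrier (mpoly_ring k)" "u \<in> Units (mpoly_ring k)"
      "F (Suc k) = f + mvar (Suc k) * u"
      using assms by (auto simp: Tri_def dest!: bspec[of _ _ "Suc k"])
    have "restrict F {1..k} \<in> Tri k"
      using F assms by (auto simp: Tri_def)
    moreover have "F = (restrict F {1..k})(Suc k := f + mvar (Suc k) * u)"
      using F fu(3) by (auto simp: Tri_def extensional_def fun_eq_iff restrict_def)
    ultimately show "F \<in> ?T" using fu by blast
  qed
  show "?T \<subseteq> Tri (Suc k)"
    using assms by (fastforce simp: Tri_def extensional_def)
qed

lemma Tri_closed:
  assumes "F \<in> Tri n" "1 \<le> i" "i \<le> n"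
  shows "F i \<in> carrier (mpoly_ring i)"
proof (cases "i = 1")
  case True
  with assms show ?thesis using comp_units_closed[of "F 1"] by (simp add: Tri_def)
next
  case False
  with assms obtain f u where "f \<in> carrier (mpoly_ring (i - 1))" "u \<in> Units (mpoly_ring (i - 1))"
    "F i = f + mvar i * u"
    by (force simp: Tri_def)
  then show ?thesis using assms mpoly_ring_mono[of _ "i - 1" i]
    by (auto simp: Units_imp_carrier intro!: mpoly_closed)
qed

lemma Tri_closed': "F \<in> Tri n \<Longrightarrow> 1 \<le> i \<Longrightarrow> i \<le> n \<Longrightarrow> F i \<in> carrier (mpoly_ring n)"
  using Tri_closed mpoly_ring_mono by blast

lemma Tri_extensional: "F \<in> Tri n \<Longrightarrow> F \<in> extensional {1..n}"
  by (simp add: Tri_def)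

lemma tuple_comp_Suc:
  assumes F: "\<And>i. 1 \<le> i \<Longrightarrow> i \<le> k \<Longrightarrow> F i \<in> carrier (mpoly_ring k)"
    and f: "f \<in> carrier (mpoly_ring k)" and u: "u \<in> carrier (mpoly_ring k)"
  shows "tuple_comp (Suc k) (F(Suc k := f + mvar (Suc k) * u)) (G(Suc k := g + mvar (Suc k) * v)) =
    (tuple_comp k F G)(Suc k := (msubst G f + g * msubst G u) + mvar (Suc k) * (msubst G u * v))"
    (is "?L = ?R")
proof
  fix i
  have *: "msubst (G(Suc k := p)) q = msubst G q" if "q \<in> carrier (mpoly_ring k)" for p q
    using that by (rule msubst_cong) auto
  show "?L i = ?R i"
    by (auto simp: tuple_comp_def * F f u algebra_simps)
qed

lemma tuple_comp_assoc:
  assumes "\<And>i. 1 \<le> i \<Longrightarrow> i \<le> n \<Longrightarrow> F i \<in> carrier (mpoly_ring n)"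
  shows "tuple_comp n (tuple_comp n F G) H = tuple_comp n F (tuple_comp n G H)"
  unfolding tuple_comp_def by (rule ext) (auto intro!: msubst_msubst[OF assms])

lemma tuple_comp_id_left:
  assumes "F \<in> extensional {1..n}"
  shows "tuple_comp n (\<lambda>i\<in>{1..n}. mvar i) F = F"
  using assms unfolding tuple_comp_def by (intro extensionalityI[of _ "{1..n}"]) auto

lemma tuple_comp_1:
  assumes "P \<in> carrier (mpoly_ring 1)"
  shows "tuple_comp 1 (\<lambda>i\<in>{1..1}. P) (\<lambda>i\<in>{1..1}. Q) = (\<lambda>i\<in>{1..1}. msubst (\<lambda>_. Q) P)"
  using msubst_cong[OF assms, of "\<lambda>i\<in>{1..1}. Q" "\<lambda>_. Q"] unfolding tuple_comp_def by (auto simp: fun_eq_iff)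

lemma Tri_comp:
  assumes "n \<ge> 1" "F \<in> Tri n" "G \<in> Tri n"
  shows "tuple_comp n F G \<in> Tri n"
  using assms
proof (induction n arbitrary: F G rule: nat_induct_at_least)
  case base
  then obtain P Q where "P \<in> comp_units" "F = (\<lambda>i\<in>{1..1}. P)" "Q \<in> comp_units" "G = (\<lambda>i\<in>{1..1}. Q)"
    unfolding Tri_1 by blast
  then show ?case unfolding Tri_1 using tuple_comp_1[OF comp_units_closed, of P Q]
    by (metis (no_types) comp_units_comp imageI)
next
  case (Suc k)
  then obtain F' f u G' g v where *:
    "F = F'(Suc k := f + mvar (Suc k) * u)" "F' \<in> Tri k" "f \<in> carrier (mpoly_ring k)" "u \<in> Units (mpoly_ring k)"
    "G = G'(Suc k := g + mvar (Suc k) * v)" "G' \<in> Tri k" "g \<in> carrier (mpoly_ring k)" "v \<in> Units (mpoly_ring k)"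
    unfolding Tri_Suc[OF Suc.hyps] by blast
  have "msubst G' u \<in> Units (mpoly_ring k)"
    by (rule Units_msubst[OF *(4) Tri_closed'[OF *(6)]])
  moreover have "msubst G' f \<in> carrier (mpoly_ring k)"
    by (rule msubst_closed[OF *(3) Tri_closed'[OF *(6)]])
  ultimately show ?case
    unfolding Tri_Suc[OF Suc.hyps] *(1,5)
    using Suc.IH[OF *(2,6)] *
    by (subst tuple_comp_Suc)
       (auto simp: Tri_closed' Units_imp_carrier intro!: mpoly_closed Units_mult_closed exI)
qed

lemma one_in_Units: "1 \<in> Units (mpoly_ring k)"
  by (rule Units_mpoly_ringI[of _ _ 1]) (simp_all add: mpoly_closed)

lemma id_Tri:
  assumes "n \<ge> 1"
  shows "(\<lambda>i\<in>{1..n}. mvar i) \<in> Tri n"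
proof -
  have "\<exists>f\<in>carrier (mpoly_ring (i - 1)). \<exists>u\<in>Units (mpoly_ring (i - 1)). mvar i = f + mvar i * u" for i
    by (rule bexI[of _ 0], rule bexI[of _ 1]) (auto simp: mpoly_closed one_in_Units)
  with assms comp_units_mvar show ?thesis by (auto simp: Tri_def)
qed

lemma id_Suc:
  "(\<lambda>i\<in>{1..Suc k}. mvar i) = (\<lambda>i\<in>{1..k}. mvar i)(Suc k := 0 + mvar (Suc k) * 1)"
  by (auto simp: fun_eq_iff)

lemma Tri_inverse:
  assumes "n \<ge> 1" "F \<in> Tri n"
  shows "\<exists>G\<in>Tri n. tuple_comp n F G = (\<lambda>i\<in>{1..n}. mvar i) \<and> tuple_comp n G F = (\<lambda>i\<in>{1..n}. mvar i)"
  using assms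
proof (induction n arbitrary: F rule: nat_induct_at_least)
  case base
  then obtain P where P: "P \<in> comp_units" "F = (\<lambda>i\<in>{1..1}. P)"
    unfolding Tri_1 by blast
  then obtain Q where Q: "Q \<in> comp_units" "msubst (\<lambda>_. Q) P = mvar 1" "msubst (\<lambda>_. P) Q = mvar 1"
    by (auto simp: comp_units_def)
  show ?case unfolding Tri_1
  proof (intro bexI conjI)
    show "tuple_comp 1 F (\<lambda>i\<in>{1..1}. Q) = (\<lambda>i\<in>{1..1}. mvar i)"
      using tuple_comp_1[OF comp_units_closed[OF P(1)], of Q] P(2) Q(2) by (simp only:) (auto simp: fun_eq_iff)
    show "tuple_comp 1 (\<lambda>i\<in>{1..1}. Q) F = (\<lambda>i\<in>{1..1}. mvar i)"
      using tuple_comp_1[OF comp_units_closed[OF Q(1)], of P] P(2) Q(3) by (simp only:) (auto simp: fun_eq_iff)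
  qed (use Q in blast)
next
  case (Suc k)
  then obtain F' f u where *:
    "F = F'(Suc k := f + mvar (Suc k) * u)" "F' \<in> Tri k" "f \<in> carrier (mpoly_ring k)" "u \<in> Units (mpoly_ring k)"
    unfolding Tri_Suc[OF Suc.hyps] by blast
  obtain G' where G': "G' \<in> Tri k" "tuple_comp k F' G' = (\<lambda>i\<in>{1..k}. mvar i)"
    "tuple_comp k G' F' = (\<lambda>i\<in>{1..k}. mvar i)"
    using Suc.IH[OF *(2)] by blast
  obtain w where w: "w \<in> Units (mpoly_ring k)" "u * w = 1"
    using *(4) by (auto simp: Units_mpoly_ring mult.commute)
  have inv: "msubst F' (msubst G' p) = p" if "p \<in> carrier (mpoly_ring k)" for p
  proof -
    have "msubst F' (msubst G' p) = msubst mvar p"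
      using that
    proof (rule msubst_msubst)
      show "msubst F' (G' i) = mvar i" if "1 \<le> i" "i \<le> k" for i
        using fun_cong[OF G'(3), of i] that by (simp add: tuple_comp_def)
    qed
    with that show ?thesis by (simp add: msubst_id)
  qed
  have uw: "msubst G' u * msubst G' w = 1" using w(2) by (metis msubst_1 msubst_mult)
  define g where "g = - msubst G' f * msubst G' w"
  define v where "v = msubst G' w"
  have v: "v \<in> Units (mpoly_ring k)" unfolding v_def
    by (rule Units_msubst[OF w(1) Tri_closed'[OF G'(1)]])
  have g: "g \<in> carrier (mpoly_ring k)" unfolding g_def
    using msubst_closed[OF *(3) Tri_closed'[OF G'(1)]] v
    by (auto simp: v_def Units_imp_carrier intro!: mpoly_closed)
  have "G'(Suc k := g + mvar (Suc k) * v) \<in> Tri (Suc k)"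
    unfolding Tri_Suc[OF Suc.hyps] using G' g v by blast
  moreover have "msubst G' f + g * msubst G' u = msubst G' f * (1 - msubst G' u * msubst G' w)"
    by (simp add: g_def algebra_simps)
  then have "tuple_comp (Suc k) F (G'(Suc k := g + mvar (Suc k) * v)) = (\<lambda>i\<in>{1..Suc k}. mvar i)"
    unfolding id_Suc *(1) using * G' uw
    by (subst tuple_comp_Suc) (auto simp: Tri_closed' Units_imp_carrier v_def)
  moreover have "msubst F' v = w" "msubst F' g = - f * w"
    using * w by (simp_all add: v_def g_def inv Units_imp_carrier)
  then have "tuple_comp (Suc k) (G'(Suc k := g + mvar (Suc k) * v)) F = (\<lambda>i\<in>{1..Suc k}. mvar i)"
    unfolding id_Suc *(1) using * G' g v w(2)
    by (subst tuple_comp_Suc) (auto simp: Tri_closed' Units_imp_carrier mult.commute)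
  ultimately show ?case by blast
qed

lemma MT_simps [simp]:
  "monoid.mult (MT n) = tuple_comp n" "one (MT n) = (\<lambda>i\<in>{1..n}. mvar i)"
  by (simp_all add: MT_def)

lemma Tri_subset_MT: "Tri n \<subseteq> carrier (MT n :: 'a::comm_ring_1 mtuple monoid)"
proof
  fix F :: "'a mtuple" assume F: "F \<in> Tri n"
  obtain P where P: "P \<in> carrier (mpoly_ring 1)" "msubst (\<lambda>_. P) (F 1) = mvar 1" "msubst (\<lambda>_. F 1) P = mvar 1"
    and F1: "F 1 \<in> carrier (mpoly_ring 1)"
    using F by (auto simp: Tri_def comp_units_def)
  have "bij (\<lambda>a. meval (\<lambda>_. a) (F 1))"
  proof (rule o_bij[of "\<lambda>a. meval (\<lambda>_. a) P"])
    show "(\<lambda>a. meval (\<lambda>_. a) P) \<circ> (\<lambda>a. meval (\<lambda>_. a) (F 1)) = id"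
      using meval_msubst[OF P(1), of "\<lambda>_. a" "\<lambda>_. F 1" "\<lambda>_. meval (\<lambda>_. a) (F 1)" for a] P
      by (simp add: fun_eq_iff)
    show "(\<lambda>a. meval (\<lambda>_. a) (F 1)) \<circ> (\<lambda>a. meval (\<lambda>_. a) P) = id"
      using meval_msubst[OF F1, of "\<lambda>_. a" "\<lambda>_. P" "\<lambda>_. meval (\<lambda>_. a) P" for a] P
      by (simp add: fun_eq_iff)
  qed
  moreover have "unit_valued k u" if u: "u \<in> Units (mpoly_ring k)" for u :: "'a mpoly" and k
  proof -
    obtain v where v: "u * v = 1" using u by (auto simp: Units_mpoly_ring)
    then have "meval a u * meval a v = 1" for a by (metis meval_simps(2,6))
    then have "meval a u dvd 1" for a by (metis dvdI)
    with u show ?thesis by (auto simp: unit_valued_def Units_imp_carrier)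
  qed
  ultimately show "F \<in> carrier (MT n)"
    using F F1 by (fastforce simp: MT_def Tri_def dest: Units_imp_carrier)
qed

text \<open>
  If \<open>F \<circ> G\<close> is the identity and \<open>F i = f + x\<^sub>i u\<close>, \<open>G i = g + x\<^sub>i v\<close>, comparing coefficients of
  \<open>x\<^sub>i\<close> gives \<open>u(G) v = 1\<close>.
\<close>

lemma MT_inverse_unit:
  assumes F: "F \<in> carrier (MT n)" and G: "G \<in> carrier (MT n)"
    and FG: "tuple_comp n F G = (\<lambda>i\<in>{1..n}. mvar i)" and i: "i \<in> {2..n}"
  shows "\<exists>f\<in>carrier (mpoly_ring (i - 1)). \<exists>u\<in>Units (mpoly_ring (i - 1)). G i = f + mvar i * u"
proof -
  obtain f u where f: "f \<in> carrier (mpoly_ring (i - 1))" and u: "u \<in> carrier (mpoly_ring (i - 1))"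
    and Fi: "F i = f + mvar i * u"
    using F i by (force simp: MT_def)
  obtain g v where g: "g \<in> carrier (mpoly_ring (i - 1))" and v: "v \<in> carrier (mpoly_ring (i - 1))"
    and Gi: "G i = g + mvar i * v"
    using G i by (force simp: MT_def)
  have G_closed: "G j \<in> carrier (mpoly_ring (i - 1))" if "1 \<le> j" "j \<le> i - 1" for j
  proof (cases "j = 1")
    case True
    have "G 1 \<in> carrier (mpoly_ring 1)" using G by (simp add: MT_def)
    then have "G 1 \<in> carrier (mpoly_ring (i - 1))"
      by (rule mpoly_ring_mono) (use i in auto)
    with True show ?thesis by simp
  next
    case False
    with that G i obtain g v where "g \<in> carrier (mpoly_ring (j - 1))"
      "v \<in> carrier (mpoly_ring (j - 1))" "G j = g + mvar j * v"
      by (force simp: MT_def)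
    moreover have "j - 1 \<le> i - 1" using that by simp
    ultimately have "g \<in> carrier (mpoly_ring (i - 1))" "v \<in> carrier (mpoly_ring (i - 1))"
      using mpoly_ring_mono by blast+
    then show ?thesis unfolding \<open>G j = g + mvar j * v\<close>
      using that by (intro mpoly_closed)
  qed
  have "msubst G (f + mvar i * u) = mvar i"
    using fun_cong[OF FG, of i] i by (simp add: tuple_comp_def Fi)
  then have "(msubst G f + g * msubst G u) + mvar i * (v * msubst G u) = 0 + mvar i * 1"
    by (simp add: Gi algebra_simps)
  moreover have "msubst G f \<in> carrier (mpoly_ring (i - 1))" "msubst G u \<in> carrier (mpoly_ring (i - 1))"
    using msubst_closed f u G_closed by blast+
  ultimately have "v * msubst G u = 1" "msubst G u \<in> carrier (mpoly_ring (i - 1))"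
    using affine_eq_iff[of "msubst G f + g * msubst G u" "i - 1" "v * msubst G u" 0 1 i] i g v
    by (auto simp: mpoly_closed)
  with g v Gi show ?thesis by (blast intro: Units_mpoly_ringI)
qed

lemma Units_MT:
  assumes "n \<ge> 1"
  shows "Units (MT n) = Tri n"
proof
  show "Tri n \<subseteq> Units (MT n)"
    using Tri_subset_MT Tri_inverse[OF assms] by (fastforce simp: Units_def)
  show "Units (MT n) \<subseteq> Tri n"
  proof
    fix F assume "F \<in> Units (MT n)"
    then obtain G where F: "F \<in> carrier (MT n)" and G: "G \<in> carrier (MT n)"
      and FG: "tuple_comp n F G = (\<lambda>i\<in>{1..n}. mvar i)" and GF: "tuple_comp n G F = (\<lambda>i\<in>{1..n}. mvar i)"
      by (auto simp: Units_def)
    have F1: "F 1 \<in> carrier (mpoly_ring 1)" and G1: "G 1 \<in> carrier (mpoly_ring 1)"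
      using F G by (auto simp: MT_def)
    have "msubst (\<lambda>_. G 1) (F 1) = mvar 1"
      using fun_cong[OF FG, of 1] assms msubst_cong[OF F1, of G "\<lambda>_. G 1"]
      by (simp add: tuple_comp_def)
    moreover have "msubst (\<lambda>_. F 1) (G 1) = mvar 1"
      using fun_cong[OF GF, of 1] assms msubst_cong[OF G1, of F "\<lambda>_. F 1"]
      by (simp add: tuple_comp_def)
    ultimately have "F 1 \<in> comp_units" using F1 G1 by (auto simp: comp_units_def)
    then show "F \<in> Tri n"
      using F MT_inverse_unit[OF G F GF] by (auto simp: Tri_def MT_def)
  qed
qed

lemma carrier_TR: "n \<ge> 1 \<Longrightarrow> carrier (TR n) = Tri n"
  by (simp add: TR_def units_of_carrier Units_MT)

lemma TR_simps [simp]: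
  "monoid.mult (TR n) = tuple_comp n" "one (TR n) = (\<lambda>i\<in>{1..n}. mvar i)"
  by (simp_all add: TR_def units_of_def)

lemma group_TR:
  assumes "n \<ge> 1"
  shows "group (TR n)"
proof (rule groupI)
  fix F G H :: "'a mtuple" assume "F \<in> carrier (TR n)"
  then have F: "F \<in> Tri n" using assms by (simp add: carrier_TR)
  show "F \<otimes>\<^bsub>TR n\<^esub> G \<otimes>\<^bsub>TR n\<^esub> H = F \<otimes>\<^bsub>TR n\<^esub> (G \<otimes>\<^bsub>TR n\<^esub> H)"
    using F by (simp add: tuple_comp_assoc Tri_closed')
  show "\<exists>G\<in>carrier (TR n). G \<otimes>\<^bsub>TR n\<^esub> F = \<one>\<^bsub>TR n\<^esub>"
    using Tri_inverse[OF assms F] assms by (auto simp: carrier_TR)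
  show "\<one>\<^bsub>TR n\<^esub> \<otimes>\<^bsub>TR n\<^esub> F = F"
    using tuple_comp_id_left[OF Tri_extensional[OF F]] by simp
next
  fix F G :: "'a mtuple" assume "F \<in> carrier (TR n)" "G \<in> carrier (TR n)"
  then show "F \<otimes>\<^bsub>TR n\<^esub> G \<in> carrier (TR n)"
    using Tri_comp[OF assms] by (simp add: carrier_TR[OF assms])
next
  show "\<one>\<^bsub>TR n\<^esub> \<in> carrier (TR n)"
    unfolding carrier_TR[OF assms] TR_simps by (rule id_Tri[OF assms])
qed

section \<open>Iterated semidirect products\<close>

lemma iso_sym_of_closed:
  assumes "h \<in> iso G H" "\<And>x y. x \<in> carrier G \<Longrightarrow> y \<in> carrier G \<Longrightarrow> x \<otimes>\<^bsub>G\<^esub> y \<in> carrier G"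
  shows "H \<cong> G"
proof -
  have h: "h \<in> hom G H" "bij_betw h (carrier G) (carrier H)"
    using assms(1) by (auto simp: iso_def)
  let ?g = "inv_into (carrier G) h"
  have bij: "bij_betw ?g (carrier H) (carrier G)"
    by (rule bij_betw_inv_into[OF h(2)])
  have "?g (x \<otimes>\<^bsub>H\<^esub> y) = ?g x \<otimes>\<^bsub>G\<^esub> ?g y" if xy: "x \<in> carrier H" "y \<in> carrier H" for x y
  proof -
    have g: "?g x \<in> carrier G" "?g y \<in> carrier G"
      using bij xy by (auto simp: bij_betw_def)
    then have "h (?g x \<otimes>\<^bsub>G\<^esub> ?g y) = x \<otimes>\<^bsub>H\<^esub> y"
      using h xy by (simp add: hom_def bij_betw_inv_into_right[OF h(2)])
    with assms(2)[OF g] show ?thesis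
      by (metis bij_betw_inv_into_left[OF h(2)])
  qed
  with bij have "?g \<in> iso H G" by (auto simp: iso_def hom_def bij_betw_def)
  then show ?thesis by (auto simp: is_iso_def)
qed

lemma Aff_group_simps [simp]:
  "carrier (Aff_group k) = Units (mpoly_ring (k - 1)) \<times> carrier (mpoly_ring (k - 1))"
  "monoid.mult (Aff_group k) (u, f) (v, g) = (u * v, f + u * g)"
  "one (Aff_group k) = (1, 0)"
  by (simp_all add: Aff_group_def semidirect_left_def units_of_def)

lemma image_group_mult:
  assumes "inj_on f (carrier G)" "x \<in> carrier G" "y \<in> carrier G"
  shows "f x \<otimes>\<^bsub>image_group f G\<^esub> f y = f (x \<otimes>\<^bsub>G\<^esub> y)"
  using assms by (simp add: image_group_def)

lemma carrier_iter_semidirect_Suc: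
  "k \<ge> 1 \<Longrightarrow> carrier (iter_semidirect A B act (Suc k)) =
     {NPair t b | t b. t \<in> carrier (iter_semidirect A B act k) \<and> b \<in> carrier (B (Suc k))}"
  by (auto simp: image_group_carrier semidirect_right_def)

lemma mult_iter_semidirect_Suc:
  assumes "k \<ge> 1" "t \<in> carrier (iter_semidirect A B act k)" "t' \<in> carrier (iter_semidirect A B act k)"
    "b \<in> carrier (B (Suc k))" "b' \<in> carrier (B (Suc k))"
  shows "NPair t b \<otimes>\<^bsub>iter_semidirect A B act (Suc k)\<^esub> NPair t' b' =
    NPair (t \<otimes>\<^bsub>iter_semidirect A B act k\<^esub> t') (act (Suc k) t' b \<otimes>\<^bsub>B (Suc k)\<^esub> b')"
proof -
  let ?G = "semidirect_right (iter_semidirect A B act k) (B (Suc k)) (act (Suc k))"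
  have "inj_on (\<lambda>(t, b). NPair t b) (carrier ?G)"
    by (auto simp: inj_on_def)
  from image_group_mult[OF this, of "(t, b)" "(t', b')"] show ?thesis
    using assms by (simp add: semidirect_right_def)
qed

lemma nested_tuple_iso:
  fixes base :: "'b \<Rightarrow> 'a::comm_ring_1 mpoly" and B :: "nat \<Rightarrow> 'c monoid"
  assumes base: "(\<lambda>a. \<lambda>i\<in>{1..1}. base a) \<in> iso A (TR 1)"
    and A_closed: "\<And>x y. x \<in> carrier A \<Longrightarrow> y \<in> carrier A \<Longrightarrow> x \<otimes>\<^bsub>A\<^esub> y \<in> carrier A"
    and coord: "\<And>k. k \<ge> 2 \<Longrightarrow> coord k \<in> iso (B k) (Aff_group k)"
    and B_closed: "\<And>k x y. k \<ge> 2 \<Longrightarrow> x \<in> carrier (B k) \<Longrightarrow> y \<in> carrier (B k) \<Longrightarrow>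
      x \<otimes>\<^bsub>B k\<^esub> y \<in> carrier (B k)"
    and act_closed: "\<And>k t b. k \<ge> 2 \<Longrightarrow> nested_tuple base coord t \<in> Tri (k - 1) \<Longrightarrow> b \<in> carrier (B k) \<Longrightarrow>
      act k t b \<in> carrier (B k)"
    and act: "\<And>k t b. k \<ge> 2 \<Longrightarrow> nested_tuple base coord t \<in> Tri (k - 1) \<Longrightarrow> b \<in> carrier (B k) \<Longrightarrow>
      coord k (act k t b) =
        map_prod (msubst (nested_tuple base coord t)) (msubst (nested_tuple base coord t)) (coord k b)"
    and "n \<ge> 1"
  shows "nested_tuple base coord \<in> iso (iter_semidirect A B act n) (TR n) \<and>
    (\<forall>t\<in>carrier (iter_semidirect A B act n). level t = n) \<and>
    (\<forall>t\<in>carrier (iter_semidirect A B act n). \<forall>t'\<in>carrier (iter_semidirect A B act n).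
       t \<otimes>\<^bsub>iter_semidirect A B act n\<^esub> t' \<in> carrier (iter_semidirect A B act n))"
  using \<open>n \<ge> 1\<close>
proof (induction n rule: nat_induct_at_least)
  case base
  let ?i = "image_group NBase A" and ?N = "nested_tuple base coord"
  have inj: "inj_on NBase (carrier A)" by (auto simp: inj_on_def)
  have hom: "(\<lambda>i\<in>{1..1}. base (x \<otimes>\<^bsub>A\<^esub> y)) = tuple_comp 1 (\<lambda>i\<in>{1..1}. base x) (\<lambda>i\<in>{1..1}. base y)"
    and base_in: "(\<lambda>i\<in>{1..1}. base x) \<in> carrier (TR 1)"
    if "x \<in> carrier A" "y \<in> carrier A" for x y
    using assms(1) that by (simp_all add: iso_def hom_def Pi_def)
  have "bij_betw (?N \<circ> NBase) (carrier A) (carrier (TR 1))"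
    using assms(1) by (simp add: iso_def comp_def)
  then have "bij_betw ?N (carrier ?i) (carrier (TR 1))"
    unfolding bij_betw_def image_group_carrier image_comp by (blast intro: inj_on_imageI)
  then have "?N \<in> iso ?i (TR 1)"
    using hom base_in by (auto simp: iso_def hom_def image_group_carrier image_group_mult[OF inj] bij_betw_def)
  then show ?case
    by (auto simp: image_group_carrier image_group_mult[OF inj] A_closed)
next
  case (Suc k)
  let ?N = "nested_tuple base coord" and ?I = "iter_semidirect A B act k"
    and ?J = "iter_semidirect A B act (Suc k)"
  have k2: "Suc k \<ge> 2" using Suc.hyps by simp
  have N_bij: "bij_betw ?N (carrier ?I) (Tri k)"
    using Suc.IH by (simp add: iso_def carrier_TR[OF Suc.hyps])
  have level: "level t = k" and N_Tri: "?N t \<in> Tri k" if "t \<in> carrier ?I" for t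
    using Suc.IH that carrier_TR[OF Suc.hyps] by (auto simp: iso_def bij_betw_def)
  have N_mult: "?N (t \<otimes>\<^bsub>?I\<^esub> t') = tuple_comp k (?N t) (?N t')"
    and I_closed: "t \<otimes>\<^bsub>?I\<^esub> t' \<in> carrier ?I"
    if "t \<in> carrier ?I" "t' \<in> carrier ?I" for t t'
    using Suc.IH that by (auto simp: iso_def hom_def)
  have coord_bij: "bij_betw (coord (Suc k)) (carrier (B (Suc k))) (Units (mpoly_ring k) \<times> carrier (mpoly_ring k))"
    and coord_mult: "\<And>b b'. b \<in> carrier (B (Suc k)) \<Longrightarrow> b' \<in> carrier (B (Suc k)) \<Longrightarrow>
      coord (Suc k) (b \<otimes>\<^bsub>B (Suc k)\<^esub> b') = coord (Suc k) b \<otimes>\<^bsub>Aff_group (Suc k)\<^esub> coord (Suc k) b'"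
    using coord[OF k2] by (auto simp: iso_def hom_def)
  have coord_in: "fst (coord (Suc k) b) \<in> Units (mpoly_ring k)" "snd (coord (Suc k) b) \<in> carrier (mpoly_ring k)"
    if "b \<in> carrier (B (Suc k))" for b
    using bij_betwE[OF coord_bij] that by (auto simp: mem_Times_iff)
  have N_Suc: "?N (NPair t b) =
      (?N t)(Suc k := snd (coord (Suc k) b) + mvar (Suc k) * fst (coord (Suc k) b))"
    if "t \<in> carrier ?I" for t b
    using level[OF that] by (simp add: Let_def split: prod.splits)
  have N_Suc_Tri: "?N (NPair t b) \<in> Tri (Suc k)" if "t \<in> carrier ?I" "b \<in> carrier (B (Suc k))" for t b
    unfolding Tri_Suc[OF Suc.hyps] N_Suc[OF that(1)] using N_Tri coord_in that by blast
  have act_Suc: "act (Suc k) t b \<in> carrier (B (Suc k))"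
    "coord (Suc k) (act (Suc k) t b) = map_prod (msubst (?N t)) (msubst (?N t)) (coord (Suc k) b)"
    if "t \<in> carrier ?I" "b \<in> carrier (B (Suc k))" for t b
    using act[OF k2 _ that(2)] act_closed[OF k2 _ that(2)] N_Tri[OF that(1)] by simp_all
  have N_Suc_mult: "?N (NPair t b \<otimes>\<^bsub>?J\<^esub> NPair t' b') = tuple_comp (Suc k) (?N (NPair t b)) (?N (NPair t' b'))"
    if t: "t \<in> carrier ?I" "t' \<in> carrier ?I" and b: "b \<in> carrier (B (Suc k))" "b' \<in> carrier (B (Suc k))" for t t' b b'
  proof -
    obtain u f v g where uf: "coord (Suc k) b = (u, f)" "coord (Suc k) b' = (v, g)"
      by fastforce
    then have "u \<in> carrier (mpoly_ring k)" "f \<in> carrier (mpoly_ring k)"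
      using coord_in[OF b(1)] by (auto simp: Units_imp_carrier)
    moreover have "coord (Suc k) (act (Suc k) t' b \<otimes>\<^bsub>B (Suc k)\<^esub> b') =
        (msubst (?N t') u * v, msubst (?N t') f + msubst (?N t') u * g)"
      using coord_mult[OF act_Suc(1)[OF t(2) b(1)] b(2)] act_Suc(2)[OF t(2) b(1)] by (simp add: uf)
    ultimately show ?thesis
      using Tri_closed'[OF N_Tri[OF t(1)]]
      by (simp add: mult_iter_semidirect_Suc[OF Suc.hyps t b] N_Suc I_closed t N_mult uf
          tuple_comp_Suc mult.commute[of g] del: iter_semidirect.simps nested_tuple.simps)
  qed
  have N_Suc_inj: "t = t' \<and> b = b'"
    if t: "t \<in> carrier ?I" "t' \<in> carrier ?I" and b: "b \<in> carrier (B (Suc k))" "b' \<in> carrier (B (Suc k))"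
      and eq: "?N (NPair t b) = ?N (NPair t' b')" for t t' b b'
  proof -
    have "snd (coord (Suc k) b) + mvar (Suc k) * fst (coord (Suc k) b) =
      snd (coord (Suc k) b') + mvar (Suc k) * fst (coord (Suc k) b')"
      using fun_cong[OF eq, of "Suc k"] by (simp add: N_Suc t del: nested_tuple.simps)
    then have "coord (Suc k) b = coord (Suc k) b'"
      using coord_in[OF b(1)] coord_in[OF b(2)]
      by (subst (asm) affine_eq_iff[of _ k]) (auto simp: Units_imp_carrier prod_eq_iff)
    then have "b = b'" using coord_bij b by (auto simp: bij_betw_def inj_on_def)
    moreover have "?N t = ?N t'"
    proof (rule extensionalityI[of _ "{1..k}"])
      show "?N t i = ?N t' i" if "i \<in> {1..k}" for i
        using fun_cong[OF eq, of i] that by (simp add: N_Suc t del: nested_tuple.simps)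
    qed (use N_Tri t Tri_extensional in blast)+
    then have "t = t'" using Suc.IH t by (auto simp: iso_def bij_betw_def inj_on_def)
    ultimately show ?thesis by simp
  qed
  have J: "carrier ?J = {NPair t b | t b. t \<in> carrier ?I \<and> b \<in> carrier (B (Suc k))}"
    by (rule carrier_iter_semidirect_Suc[OF Suc.hyps])
  have "Tri (Suc k) \<subseteq> ?N ` carrier ?J"
  proof
    fix F :: "'a mtuple" assume "F \<in> Tri (Suc k)"
    then obtain F' f u where F: "F = F'(Suc k := f + mvar (Suc k) * u)" "F' \<in> Tri k"
      "f \<in> carrier (mpoly_ring k)" "u \<in> Units (mpoly_ring k)"
      unfolding Tri_Suc[OF Suc.hyps] by blast
    obtain t where t: "t \<in> carrier ?I" "F' = ?N t"
      using F(2) bij_betw_imp_surj_on[OF N_bij] by (metis imageE)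
    have "(u, f) \<in> coord (Suc k) ` carrier (B (Suc k))"
      using F(3,4) by (simp add: bij_betw_imp_surj_on[OF coord_bij])
    then obtain b where b: "b \<in> carrier (B (Suc k))" "coord (Suc k) b = (u, f)"
      by force
    have "F = ?N (NPair t b)" using t b F by (simp add: N_Suc del: nested_tuple.simps)
    with t b show "F \<in> ?N ` carrier ?J" unfolding J by blast
  qed
  moreover have "?N ` carrier ?J \<subseteq> Tri (Suc k)"
    unfolding J using N_Suc_Tri by blast
  moreover have "inj_on ?N (carrier ?J)"
    unfolding J using N_Suc_inj by (intro inj_onI) blast
  ultimately have "bij_betw ?N (carrier ?J) (carrier (TR (Suc k)))"
    unfolding bij_betw_def carrier_TR[OF le_SucI[OF Suc.hyps]] by blast
  moreover have "?N (x \<otimes>\<^bsub>?J\<^esub> y) = ?N x \<otimes>\<^bsub>TR (Suc k)\<^esub> ?N y"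
    if "x \<in> carrier ?J" "y \<in> carrier ?J" for x y
    using that N_Suc_mult unfolding J TR_simps by blast
  ultimately have "?N \<in> iso ?J (TR (Suc k))"
    by (auto simp only: iso_def hom_def bij_betw_def)
  moreover have "x \<otimes>\<^bsub>?J\<^esub> y \<in> carrier ?J" if xy: "x \<in> carrier ?J" "y \<in> carrier ?J" for x y
  proof -
    obtain t b t' b' where *: "t \<in> carrier ?I" "t' \<in> carrier ?I"
      "b \<in> carrier (B (Suc k))" "b' \<in> carrier (B (Suc k))" "x = NPair t b" "y = NPair t' b'"
      using xy unfolding J by blast
    have "act (Suc k) t' b \<otimes>\<^bsub>B (Suc k)\<^esub> b' \<in> carrier (B (Suc k))"
      by (rule B_closed[OF k2 act_Suc(1)[OF *(2,3)] *(4)])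
    with I_closed[OF *(1,2)] show ?thesis
      unfolding J *(5,6) mult_iter_semidirect_Suc[OF Suc.hyps *(1-4)] by blast
  qed
  moreover have "level x = Suc k" if "x \<in> carrier ?J" for x
    using that level unfolding J by auto
  ultimately show ?case by blast
qed

corollary TR_iso_iter_semidirect:
  fixes base :: "'b \<Rightarrow> 'a::comm_ring_1 mpoly" and B :: "nat \<Rightarrow> 'c monoid"
  assumes "(\<lambda>a. \<lambda>i\<in>{1..1}. base a) \<in> iso A (TR 1)"
    and "\<And>x y. x \<in> carrier A \<Longrightarrow> y \<in> carrier A \<Longrightarrow> x \<otimes>\<^bsub>A\<^esub> y \<in> carrier A"
    and "\<And>k. k \<ge> 2 \<Longrightarrow> coord k \<in> iso (B k) (Aff_group k)"
    and "\<And>k x y. k \<ge> 2 \<Longrightarrow> x \<in> carrier (B k) \<Longrightarrow> y \<in> carrier (B k) \<Longrightarrow>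
      x \<otimes>\<^bsub>B k\<^esub> y \<in> carrier (B k)"
    and "\<And>k t b. k \<ge> 2 \<Longrightarrow> nested_tuple base coord t \<in> Tri (k - 1) \<Longrightarrow> b \<in> carrier (B k) \<Longrightarrow>
      act k t b \<in> carrier (B k)"
    and "\<And>k t b. k \<ge> 2 \<Longrightarrow> nested_tuple base coord t \<in> Tri (k - 1) \<Longrightarrow> b \<in> carrier (B k) \<Longrightarrow>
      coord k (act k t b) =
        map_prod (msubst (nested_tuple base coord t)) (msubst (nested_tuple base coord t)) (coord k b)"
    and "n \<ge> 1"
  shows "(TR n :: 'a mtuple monoid) \<cong> iter_semidirect A B act n"
  using nested_tuple_iso[of base A coord B act n, OF assms]
  by (intro iso_sym_of_closed[of "nested_tuple base coord"]) auto

section \<open>The univariate factor and the first two decompositions\<close>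

lemma poly_to_mpoly_0 [simp]: "poly_to_mpoly 0 = 0"
  by (simp add: poly_to_mpoly_def)

lemma poly_to_mpoly_pCons: "poly_to_mpoly (pCons a p) = mconst a + mvar 1 * poly_to_mpoly p"
  by (simp add: poly_to_mpoly_def map_poly_pCons)

lemma poly_to_mpoly_add: "poly_to_mpoly (p + q) = poly_to_mpoly p + poly_to_mpoly q"
  by (induction p q rule: poly_induct2) (simp_all add: poly_to_mpoly_pCons mconst_add algebra_simps)

lemma poly_to_mpoly_smult: "poly_to_mpoly (smult a p) = mconst a * poly_to_mpoly p"
  by (induction p) (simp_all add: poly_to_mpoly_pCons mconst_mult algebra_simps)

lemma poly_to_mpoly_mult: "poly_to_mpoly (p * q) = poly_to_mpoly p * poly_to_mpoly q"
  by (induction p)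
     (simp_all add: poly_to_mpoly_pCons poly_to_mpoly_add poly_to_mpoly_smult algebra_simps)

lemma poly_to_mpoly_pcompose:
  "poly_to_mpoly (pcompose p q) = msubst (\<lambda>_. poly_to_mpoly q) (poly_to_mpoly p)"
  by (induction p)
     (simp_all add: pcompose_pCons poly_to_mpoly_pCons poly_to_mpoly_add poly_to_mpoly_mult)

lemma poly_to_mpoly_closed: "poly_to_mpoly p \<in> carrier (mpoly_ring 1)"
  by (induction p) (auto simp: poly_to_mpoly_pCons mpoly_closed)

lemma inj_poly_to_mpoly: "inj poly_to_mpoly"
proof (rule inj_on_inverseI)
  show "minsert (\<lambda>c. [:c:]) (\<lambda>_. [:0, 1:]) (poly_to_mpoly p) = p" for p :: "'a poly"
  proof (induction p)
    case 0
    show ?case using pconst_hom.minsert_mconst[of _ 0] by simp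
  qed (simp add: poly_to_mpoly_pCons pconst_hom.minsert_add pconst_hom.minsert_mult
        pconst_hom.minsert_mconst pconst_hom.minsert_mvar)
qed

lemma poly_to_mpoly_X: "poly_to_mpoly [:0, 1:] = mvar 1"
  by (simp add: poly_to_mpoly_pCons)

lemma range_poly_to_mpoly:
  "range poly_to_mpoly = (carrier (mpoly_ring 1) :: 'a::comm_ring_1 mpoly set)" (is "?L = ?R")
proof
  show "?R \<subseteq> ?L"
  proof
    fix P :: "'a mpoly" assume "P \<in> carrier (mpoly_ring 1)"
    then show "P \<in> ?L"
    proof (induction rule: mpoly_ring_induct)
      case (const c)
      have "mconst c = poly_to_mpoly [:c:]" by (simp add: poly_to_mpoly_pCons)
      then show ?case by blast
    next
      case (var i)
      then have "mvar i = poly_to_mpoly [:0, 1:]" by (simp add: poly_to_mpoly_X)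
      then show ?case by blast
    next
      case (add P Q)
      then show ?case by (auto simp: poly_to_mpoly_add[symmetric])
    next
      case (mult P Q)
      then show ?case by (auto simp: poly_to_mpoly_mult[symmetric])
    qed
  qed
qed (use poly_to_mpoly_closed in blast)

lemma carrier_Aut_Rx:
  "carrier Aut_Rx = {p. \<exists>q. pcompose p q = [:0, 1:] \<and> pcompose q p = [:0, 1:]}"
  by (auto simp: Aut_Rx_def units_of_def Units_def)

lemma Aut_Rx_simps [simp]: "monoid.mult Aut_Rx = pcompose" "one Aut_Rx = [:0, 1:]"
  by (simp_all add: Aut_Rx_def units_of_def)

lemma group_Aut_Rx: "group (Aut_Rx :: 'a::comm_ring_1 poly monoid)"
  unfolding Aut_Rx_def
  by (rule monoid.units_group, rule monoidI) (simp_all add: pcompose_assoc pcompose_pCons)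

lemma comp_units_eq_image: "comp_units = poly_to_mpoly ` carrier Aut_Rx"
proof -
  have eq: "msubst (\<lambda>_. poly_to_mpoly q) (poly_to_mpoly p) = mvar 1 \<longleftrightarrow> pcompose p q = [:0, 1:]"
    for p q :: "'a poly"
    unfolding poly_to_mpoly_pcompose[symmetric] poly_to_mpoly_X[symmetric]
    by (rule inj_eq[OF inj_poly_to_mpoly])
  show ?thesis
    unfolding comp_units_def range_poly_to_mpoly[symmetric] carrier_Aut_Rx using eq by auto
qed

lemma Aut_Rx_iso_TR_1:
  "(\<lambda>p::'a::comm_ring_1 poly. \<lambda>i\<in>{1..1}. poly_to_mpoly p) \<in> iso Aut_Rx (TR 1)"
proof -
  let ?h = "\<lambda>p::'a poly. \<lambda>i\<in>{1..1::nat}. poly_to_mpoly p"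
  have "inj_on ?h (carrier Aut_Rx)"
  proof (rule inj_onI)
    fix p q :: "'a poly" assume eq: "?h p = ?h q"
    show "p = q" using fun_cong[OF eq, of 1] by (simp add: inj_eq[OF inj_poly_to_mpoly])
  qed
  moreover have "?h ` carrier Aut_Rx = carrier (TR 1)"
    unfolding carrier_TR[OF order_refl] Tri_1 comp_units_eq_image image_image ..
  moreover have "?h (pcompose p q) = tuple_comp 1 (?h p) (?h q)" for p q :: "'a poly"
    by (subst tuple_comp_1) (simp_all only: poly_to_mpoly_closed poly_to_mpoly_pcompose)
  ultimately show ?thesis
    unfolding iso_def hom_def bij_betw_def by auto
qed

lemma Aut_Rx_mult_closed:
  "p \<in> carrier Aut_Rx \<Longrightarrow> q \<in> carrier Aut_Rx \<Longrightarrow> p \<otimes>\<^bsub>Aut_Rx\<^esub> q \<in> carrier Aut_Rx"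
  using group_Aut_Rx by (rule monoid.m_closed[OF group.is_monoid])

lemma Aff_group_mult_closed:
  assumes "x \<in> carrier (Aff_group k)" "y \<in> carrier (Aff_group k)"
  shows "x \<otimes>\<^bsub>Aff_group k\<^esub> y \<in> carrier (Aff_group k)"
  using assms by (cases x; cases y) (auto simp: Units_imp_carrier intro!: Units_mult_closed mpoly_closed)

lemma id_iso_Aff_group: "(\<lambda>b. b) \<in> iso (Aff_group k) (Aff_group k)"
  by (rule iso_set_refl)

lemma Units_msubst_Tri: "h \<in> Tri k \<Longrightarrow> u \<in> Units (mpoly_ring k) \<Longrightarrow> msubst h u \<in> Units (mpoly_ring k)"
  using Units_msubst Tri_closed' by blast

lemma msubst_Tri_closed:
  "h \<in> Tri k \<Longrightarrow> f \<in> carrier (mpoly_ring k) \<Longrightarrow> msubst h f \<in> carrier (mpoly_ring k)"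
  using msubst_closed Tri_closed' by blast

lemma TR_iso_Aff_product:
  assumes "n \<ge> 1"
  shows "(TR n :: 'a::comm_ring_1 mtuple monoid) \<cong> (Aff_product n :: ('a poly, 'a mpoly \<times> 'a mpoly) nested monoid)"
  unfolding Aff_product_def
  using Aut_Rx_iso_TR_1 Aut_Rx_mult_closed id_iso_Aff_group Aff_group_mult_closed _ _ assms
  by (rule TR_iso_iter_semidirect)
     (auto simp: Aff_act_def Let_def Units_msubst_Tri msubst_Tri_closed)

lemma lin_elem_Suc:
  "lin_elem (Suc k) (Suc k) u f = (\<lambda>i\<in>{1..k}. mvar i)(Suc k := f + mvar (Suc k) * u)"
  by (auto simp: lin_elem_def fun_eq_iff)

lemma lin_elem_Suc_in_Tri:
  "k \<ge> 1 \<Longrightarrow> u \<in> Units (mpoly_ring k) \<Longrightarrow> f \<in> carrier (mpoly_ring k) \<Longrightarrow>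
    lin_elem (Suc k) (Suc k) u f \<in> Tri (Suc k)"
  unfolding Tri_Suc lin_elem_Suc using id_Tri by blast

lemma lin_elem_mult:
  assumes "u \<in> carrier (mpoly_ring k)" "f \<in> carrier (mpoly_ring k)"
    "v \<in> carrier (mpoly_ring k)" "g \<in> carrier (mpoly_ring k)"
  shows "tuple_comp (Suc k) (lin_elem (Suc k) (Suc k) u f) (lin_elem (Suc k) (Suc k) v g) =
    lin_elem (Suc k) (Suc k) (u * v) (f + u * g)"
proof -
  let ?id = "\<lambda>i\<in>{1..k}. mvar i :: 'a mpoly"
  have "msubst ?id p = p" if "p \<in> carrier (mpoly_ring k)" for p
    using that by (rule msubst_id) simp
  then have "tuple_comp (Suc k) (?id(Suc k := f + mvar (Suc k) * u)) (?id(Suc k := g + mvar (Suc k) * v)) =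
      (tuple_comp k ?id ?id)(Suc k := (f + g * u) + mvar (Suc k) * (u * v))"
    using assms by (subst tuple_comp_Suc) (simp_all add: mpoly_closed)
  also have "tuple_comp k ?id ?id = ?id"
    by (rule tuple_comp_id_left) simp
  finally show ?thesis by (simp only: lin_elem_Suc mult.commute[of g])
qed

lemma lin_elem_iso:
  assumes "k \<ge> 2"
  shows "(\<lambda>(u, f). lin_elem k k u f :: 'a::comm_ring_1 mtuple) \<in> iso (Aff_group k) (Lin k k)"
proof -
  obtain j where k: "k = Suc j" "j \<ge> 1" using assms by (cases k) auto
  let ?l = "\<lambda>(u, f). lin_elem k k u f :: 'a mtuple"
  have "inj_on ?l (carrier (Aff_group k))"
  proof (rule inj_onI, clarify)
    fix u f v g :: "'a mpoly"
    assume "(u, f) \<in> carrier (Aff_group k)" "(v, g) \<in> carrier (Aff_group k)"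
    then have "f + mvar k * u = g + mvar k * v \<longleftrightarrow> f = g \<and> u = v"
      using k by (intro affine_eq_iff[of _ j]) (auto simp: Units_imp_carrier)
    moreover assume eq: "lin_elem k k u f = lin_elem k k v g"
    have "f + mvar k * u = g + mvar k * v"
      using fun_cong[OF eq, of k] k(1) by (simp add: lin_elem_def)
    ultimately show "u = v \<and> f = g" by blast
  qed
  moreover have surj: "?l ` carrier (Aff_group k) = carrier (Lin k k)"
    unfolding Lin_def Aff_group_simps by force
  moreover have "?l (x \<otimes>\<^bsub>Aff_group k\<^esub> y) = ?l x \<otimes>\<^bsub>Lin k k\<^esub> ?l y"
    if "x \<in> carrier (Aff_group k)" "y \<in> carrier (Aff_group k)" for x y
    using that k by (cases x; cases y) (simp add: Lin_def lin_elem_mult Units_imp_carrier)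
  ultimately show ?thesis
    unfolding iso_iff hom_def by blast
qed

lemma Lin_coord_eq: "Lin_coord k = the_inv_into (carrier (Aff_group k)) (\<lambda>(u, f). lin_elem k k u f)"
  by (simp add: Lin_coord_def)

lemma Lin_coord_lin_elem:
  assumes "k \<ge> 2" "u \<in> Units (mpoly_ring (k - 1))" "f \<in> carrier (mpoly_ring (k - 1))"
  shows "Lin_coord k (lin_elem k k u f) = (u, f)"
proof -
  have "inj_on (\<lambda>(u, f). lin_elem k k u f) (carrier (Aff_group k))"
    using lin_elem_iso[OF assms(1)] unfolding iso_iff by blast
  moreover have "(u, f) \<in> carrier (Aff_group k)" using assms by simp
  ultimately show ?thesis
    unfolding Lin_coord_eq using the_inv_into_f_f[of "\<lambda>(u, f). lin_elem k k u f" _ "(u, f)"]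
    by (simp only: prod.case)
qed

lemma Lin_mult_closed:
  fixes x y :: "'a::comm_ring_1 mtuple"
  assumes "k \<ge> 2" "x \<in> carrier (Lin k k)" "y \<in> carrier (Lin k k)"
  shows "x \<otimes>\<^bsub>Lin k k\<^esub> y \<in> carrier (Lin k k)"
proof -
  let ?l = "\<lambda>(u, f). lin_elem k k u f :: 'a mtuple"
  have l: "?l \<in> hom (Aff_group k) (Lin k k)" "?l ` carrier (Aff_group k) = carrier (Lin k k)"
    using lin_elem_iso[OF assms(1)] unfolding iso_iff by blast+
  obtain a where a: "a \<in> carrier (Aff_group k)" "x = ?l a"
    using assms(2) unfolding l(2)[symmetric] by blast
  obtain b where b: "b \<in> carrier (Aff_group k)" "y = ?l b"
    using assms(3) unfolding l(2)[symmetric] by blast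
  have "x \<otimes>\<^bsub>Lin k k\<^esub> y = ?l (a \<otimes>\<^bsub>Aff_group k\<^esub> b)"
    unfolding a(2) b(2) using hom_mult[OF l(1) a(1) b(1)] by simp
  then show ?thesis
    unfolding l(2)[symmetric] using Aff_group_mult_closed[OF a(1) b(1)] by (rule image_eqI)
qed

lemma Lin_coord_iso:
  assumes "k \<ge> 2"
  shows "Lin_coord k \<in> iso (Lin k k :: 'a::comm_ring_1 mtuple monoid) (Aff_group k)"
proof -
  let ?l = "\<lambda>(u, f). lin_elem k k u f :: 'a mtuple"
  have l: "?l \<in> hom (Aff_group k) (Lin k k)" "bij_betw ?l (carrier (Aff_group k)) (carrier (Lin k k))"
    using lin_elem_iso[OF assms(1)] unfolding iso_def by blast+
  have inj: "inj_on ?l (carrier (Aff_group k))" using l(2) by (rule bij_betw_imp_inj_on)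
  have bij: "bij_betw (Lin_coord k) (carrier (Lin k k :: 'a mtuple monoid)) (carrier (Aff_group k))"
    unfolding Lin_coord_eq by (rule bij_betw_the_inv_into[OF l(2)])
  have "Lin_coord k (x \<otimes>\<^bsub>Lin k k\<^esub> y) = Lin_coord k x \<otimes>\<^bsub>Aff_group k\<^esub> Lin_coord k y"
    if xy: "x \<in> carrier (Lin k k)" "y \<in> carrier (Lin k k)" for x y :: "'a mtuple"
  proof -
    obtain a where a: "a \<in> carrier (Aff_group k)" "x = ?l a"
      using xy(1) unfolding bij_betw_imp_surj_on[OF l(2), symmetric] by blast
    obtain b where b: "b \<in> carrier (Aff_group k)" "y = ?l b"
      using xy(2) unfolding bij_betw_imp_surj_on[OF l(2), symmetric] by blast
    have "x \<otimes>\<^bsub>Lin k k\<^esub> y = ?l (a \<otimes>\<^bsub>Aff_group k\<^esub> b)"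
      unfolding a(2) b(2) using hom_mult[OF l(1) a(1) b(1)] by simp
    then show ?thesis
      unfolding Lin_coord_eq
      by (simp only: a(2) b(2) the_inv_into_f_f[OF inj] a(1) b(1) Aff_group_mult_closed)
  qed
  moreover have "Lin_coord k \<in> carrier (Lin k k :: 'a mtuple monoid) \<rightarrow> carrier (Aff_group k)"
    using bij_betwE[OF bij] by blast
  ultimately show ?thesis unfolding iso_def hom_def using bij by blast
qed

lemma TR_iso_Lin_product:
  assumes "n \<ge> 1"
  shows "(TR n :: 'a::comm_ring_1 mtuple monoid) \<cong> (Lin_product n :: ('a poly, 'a mtuple) nested monoid)"
  unfolding Lin_product_def
  using Aut_Rx_iso_TR_1 Aut_Rx_mult_closed Lin_coord_iso Lin_mult_closed _ _ assms
proof (rule TR_iso_iter_semidirect)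
  fix k :: nat and t :: "('a poly, 'a mtuple) nested" and b :: "'a mtuple"
  let ?h = "nested_tuple poly_to_mpoly Lin_coord t"
  assume k: "k \<ge> 2" and h: "?h \<in> Tri (k - 1)" and b: "b \<in> carrier (Lin k k)"
  then obtain u f where uf: "u \<in> Units (mpoly_ring (k - 1))" "f \<in> carrier (mpoly_ring (k - 1))"
    "b = lin_elem k k u f"
    by (auto simp: Lin_def)
  have act: "Lin_act k t b = lin_elem k k (msubst ?h u) (msubst ?h f)"
    unfolding uf(3) by (simp add: Lin_act_def Let_def Lin_coord_lin_elem[OF k uf(1,2)])
  have closed: "msubst ?h u \<in> Units (mpoly_ring (k - 1))" "msubst ?h f \<in> carrier (mpoly_ring (k - 1))"
    using Units_msubst_Tri[OF h uf(1)] msubst_Tri_closed[OF h uf(2)] .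
  show "Lin_act k t b \<in> carrier (Lin k k)"
    unfolding act using closed by (auto simp: Lin_def)
  show "Lin_coord k (Lin_act k t b) = map_prod (msubst ?h) (msubst ?h) (Lin_coord k b)"
    unfolding uf(3) act[unfolded uf(3)]
    by (simp only: Lin_coord_lin_elem[OF k closed] Lin_coord_lin_elem[OF k uf(1,2)] map_prod_simp)
qed

section \<open>Solvability\<close>

lemma comm_group_imp_solvable:
  assumes "comm_group G"
  shows "solvable G"
proof -
  interpret comm_group G by (rule assms)
  have "x \<otimes>\<^bsub>G\<^esub> y \<otimes>\<^bsub>G\<^esub> inv\<^bsub>G\<^esub> x \<otimes>\<^bsub>G\<^esub> inv\<^bsub>G\<^esub> y = \<one>\<^bsub>G\<^esub>" if "x \<in> carrier G" "y \<in> carrier G" for x y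
    using that by (simp add: m_comm[of x y] m_assoc)
  then have "derived_set G (carrier G) = {\<one>\<^bsub>G\<^esub>}"
    by fastforce
  then have "(derived G ^^ 1) (carrier G) = {\<one>\<^bsub>G\<^esub>}"
    by (simp add: derived_def generate_one)
  then show ?thesis by (blast intro: solvable_iff_trivial_derived_seq[THEN iffD2])
qed

lemma affine_group_solvable:
  assumes "cring R"
  defines "G \<equiv> semidirect_left (units_of R) (add_monoid R) (\<otimes>\<^bsub>R\<^esub>)"
  shows "group G" "solvable G"
proof -
  interpret cring R by (rule assms)
  have G: "carrier G = Units R \<times> carrier R"
    "(u, f) \<otimes>\<^bsub>G\<^esub> (v, g) = (u \<otimes>\<^bsub>R\<^esub> v, f \<oplus>\<^bsub>R\<^esub> u \<otimes>\<^bsub>R\<^esub> g)" "\<one>\<^bsub>G\<^esub> = (\<one>\<^bsub>R\<^esub>, \<zero>\<^bsub>R\<^esub>)" for u f v g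
    by (simp_all add: G_def semidirect_left_def units_of_def)
  show "group G"
  proof (rule groupI)
    fix x assume "x \<in> carrier G"
    then obtain u f where x: "x = (u, f)" "u \<in> Units R" "f \<in> carrier R" by (auto simp: G)
    then have "(inv\<^bsub>R\<^esub> u, \<ominus>\<^bsub>R\<^esub> (inv\<^bsub>R\<^esub> u \<otimes>\<^bsub>R\<^esub> f)) \<otimes>\<^bsub>G\<^esub> x = \<one>\<^bsub>G\<^esub>"
      by (simp add: G l_neg)
    moreover have "(inv\<^bsub>R\<^esub> u, \<ominus>\<^bsub>R\<^esub> (inv\<^bsub>R\<^esub> u \<otimes>\<^bsub>R\<^esub> f)) \<in> carrier G"
      using x by (simp add: G)
    ultimately show "\<exists>y\<in>carrier G. y \<otimes>\<^bsub>G\<^esub> x = \<one>\<^bsub>G\<^esub>" by blast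
  qed (auto simp: G r_distr m_assoc a_assoc Units_closed)
  have units: "comm_group (units_of R)" by (rule units_comm_group)
  have "comm_group (add_monoid R)" by (rule a_comm_group)
  then have "solvable (add_monoid R)" "group (add_monoid R)"
    by (rule comm_group_imp_solvable, rule comm_group.axioms)
  have "solvable (units_of R)" "group (units_of R)"
    using units by (rule comm_group_imp_solvable, rule comm_group.axioms)
  show "solvable G"
  proof (rule solvable_condition[where f = "\<lambda>f. (\<one>\<^bsub>R\<^esub>, f)" and g = fst])
    show "group_hom (add_monoid R) G (\<lambda>f. (\<one>\<^bsub>R\<^esub>, f))"
      using \<open>group G\<close> \<open>group (add_monoid R)\<close> by (auto simp: group_hom_def group_hom_axioms_def hom_def G)
    show "group_hom G (units_of R) fst"
      using \<open>group G\<close> \<open>group (units_of R)\<close>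
      by (auto simp: group_hom_def group_hom_axioms_def hom_def G units_of_def)
    show "fst ` carrier G = carrier (units_of R)"
      by (auto simp: G units_of_def)
    show "kernel G (units_of R) fst \<subseteq> (\<lambda>f. (\<one>\<^bsub>R\<^esub>, f)) ` carrier (add_monoid R)"
      by (auto simp: kernel_def G units_of_def)
  qed fact+
qed

lemma Aff_group_eq:
  "Aff_group k = semidirect_left (units_of (mpoly_ring (k - 1))) (add_monoid (mpoly_ring (k - 1)))
     (\<otimes>\<^bsub>mpoly_ring (k - 1)\<^esub>)"
  by (simp add: Aff_group_def)

lemma group_Aff_group: "group (Aff_group k)" and solvable_Aff_group: "solvable (Aff_group k)"
  unfolding Aff_group_eq by (rule affine_group_solvable[OF cring_mpoly_ring])+

lemma lin_elem_hom:
  assumes "k \<ge> 1"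
  shows "group_hom (Aff_group (Suc k)) (TR (Suc k)) (\<lambda>(u, f). lin_elem (Suc k) (Suc k) u f)"
  using assms
  by (auto simp: group_hom_def group_hom_axioms_def group_Aff_group group_TR hom_def carrier_TR
      lin_elem_mult lin_elem_Suc_in_Tri Units_imp_carrier)

lemma restrict_Tri_upd:
  assumes "F \<in> Tri k"
  shows "restrict (F(Suc k := p)) {1..k} = F"
  using Tri_extensional[OF assms] by (intro extensionalityI[of _ "{1..k}"]) auto

lemma restrict_TR:
  assumes "k \<ge> 1"
  shows "group_hom (TR (Suc k)) (TR k) (\<lambda>F::'a::comm_ring_1 mtuple. restrict F {1..k})"
    and "(\<lambda>F::'a mtuple. restrict F {1..k}) ` carrier (TR (Suc k)) = carrier (TR k)"
    and "kernel (TR (Suc k)) (TR k) (\<lambda>F::'a mtuple. restrict F {1..k}) \<subseteq>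
      (\<lambda>(u, f). lin_elem (Suc k) (Suc k) u f) ` carrier (Aff_group (Suc k))"
proof -
  let ?r = "\<lambda>F. restrict F {1..k} :: 'a mtuple"
  have k: "Suc k \<ge> 1" by simp
  have r_Tri: "?r F \<in> Tri k" if "F \<in> Tri (Suc k)" for F
  proof -
    obtain F' f u where "F = F'(Suc k := f + mvar (Suc k) * u)" "F' \<in> Tri k"
      using \<open>F \<in> Tri (Suc k)\<close> unfolding Tri_Suc[OF assms] by blast
    then show ?thesis by (simp only: restrict_Tri_upd)
  qed
  have "?r (tuple_comp (Suc k) F G) = tuple_comp k (?r F) (?r G)"
    if "F \<in> Tri (Suc k)" "G \<in> Tri (Suc k)" for F G
  proof (rule extensionalityI[of _ "{1..k}"])
    fix i assume i: "i \<in> {1..k}"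
    then have "F i \<in> carrier (mpoly_ring k)"
      using Tri_closed'[OF r_Tri[OF that(1)], of i] by simp
    then have "msubst G (F i) = msubst (?r G) (F i)"
      by (rule msubst_cong) simp
    with i show "?r (tuple_comp (Suc k) F G) i = tuple_comp k (?r F) (?r G) i"
      by (simp add: tuple_comp_def)
  qed (simp_all add: tuple_comp_def)
  with r_Tri show "group_hom (TR (Suc k)) (TR k) ?r"
    using group_TR[OF assms] group_TR[OF k]
    by (simp add: group_hom_def group_hom_axioms_def hom_def carrier_TR[OF k] carrier_TR[OF assms])
  have "Tri k \<subseteq> ?r ` Tri (Suc k)"
  proof
    fix F :: "'a mtuple" assume F: "F \<in> Tri k"
    then have "F(Suc k := 0 + mvar (Suc k) * 1) \<in> Tri (Suc k)"
      unfolding Tri_Suc[OF assms] using mpoly_zero_closed one_in_Units by blast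
    with restrict_Tri_upd[OF F] show "F \<in> ?r ` Tri (Suc k)" by (metis imageI)
  qed
  with r_Tri show "?r ` carrier (TR (Suc k)) = carrier (TR k)"
    unfolding carrier_TR[OF assms] carrier_TR[OF k] by blast
  show "kernel (TR (Suc k)) (TR k) ?r \<subseteq>
      (\<lambda>(u, f). lin_elem (Suc k) (Suc k) u f) ` carrier (Aff_group (Suc k))"
  proof
    fix F :: "'a mtuple" assume "F \<in> kernel (TR (Suc k)) (TR k) ?r"
    then have F: "F \<in> Tri (Suc k)" "?r F = (\<lambda>i\<in>{1..k}. mvar i)"
      by (simp_all add: kernel_def carrier_TR)
    then obtain F' f u where F': "F = F'(Suc k := f + mvar (Suc k) * u)" "F' \<in> Tri k"
      "f \<in> carrier (mpoly_ring k)" "u \<in> Units (mpoly_ring k)"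
      unfolding Tri_Suc[OF assms] by blast
    then have "F' = (\<lambda>i\<in>{1..k}. mvar i)"
      using F(2) restrict_Tri_upd by metis
    then have "F = lin_elem (Suc k) (Suc k) u f"
      unfolding lin_elem_Suc F'(1) by simp
    with F'(3,4) show "F \<in> (\<lambda>(u, f). lin_elem (Suc k) (Suc k) u f) ` carrier (Aff_group (Suc k))"
      by (intro image_eqI[of _ _ "(u, f)"]) simp_all
  qed
qed

lemma solvable_TR_Suc:
  assumes "k \<ge> 1"
  shows "solvable (TR (Suc k) :: 'a::comm_ring_1 mtuple monoid) \<longleftrightarrow> solvable (TR k :: 'a mtuple monoid)"
proof
  note r = restrict_TR[OF assms, where 'a = 'a]
  show "solvable (TR k :: 'a mtuple monoid)" if "solvable (TR (Suc k) :: 'a mtuple monoid)"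
    by (rule group_hom.surj_hom_imp_solvable[OF r(1,2) that])
  show "solvable (TR (Suc k) :: 'a mtuple monoid)" if "solvable (TR k :: 'a mtuple monoid)"
    by (rule solvable_condition[OF lin_elem_hom[OF assms] r solvable_Aff_group that])
qed

lemma iso_imp_solvable_iff:
  assumes "h \<in> iso G H" "group G" "group H"
  shows "solvable G \<longleftrightarrow> solvable H"
proof -
  have "group_hom G H h"
    using assms by (simp add: group_hom_def group_hom_axioms_def iso_def)
  then show ?thesis
    using assms(1) group_hom.surj_hom_imp_solvable group_hom.inj_hom_imp_solvable
    unfolding iso_iff by blast
qed

lemma solvable_TR_iff_TR_1:
  assumes "n \<ge> 1"
  shows "solvable (TR n :: 'a::comm_ring_1 mtuple monoid) \<longleftrightarrow> solvable (TR 1 :: 'a mtuple monoid)"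
  using assms by (induction n rule: nat_induct_at_least) (simp_all add: solvable_TR_Suc)

lemma solvable_TR_iff:
  assumes "n \<ge> 1"
  shows "solvable (TR n :: 'a::comm_ring_1 mtuple monoid) \<longleftrightarrow> solvable (Aut_Rx :: 'a poly monoid)"
  using iso_imp_solvable_iff[OF Aut_Rx_iso_TR_1 group_Aut_Rx group_TR[OF order_refl]]
    solvable_TR_iff_TR_1[OF assms] by blast

section \<open>Domains\<close>

lemma lookup_mult_top:
  fixes p q :: "'a::comm_ring_1 mpoly"
  assumes p: "\<And>k. k \<in> Poly_Mapping.keys p \<Longrightarrow> k \<le> m" and q: "\<And>k. k \<in> Poly_Mapping.keys q \<Longrightarrow> k \<le> n"
  shows "Poly_Mapping.lookup (p * q) (m + n) = Poly_Mapping.lookup p m * Poly_Mapping.lookup q n"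
proof -
  define p' where "p' = p - Poly_Mapping.single m (Poly_Mapping.lookup p m)"
  define q' where "q' = q - Poly_Mapping.single n (Poly_Mapping.lookup q n)"
  have p': "k < m" if "k \<in> Poly_Mapping.keys p'" for k
    using that p[of k] by (auto simp: p'_def in_keys_iff lookup_minus lookup_single when_def order_less_le split: if_splits)
  have q': "k < n" if "k \<in> Poly_Mapping.keys q'" for k
    using that q[of k] by (auto simp: q'_def in_keys_iff lookup_minus lookup_single when_def order_less_le split: if_splits)
  have "p * q = Poly_Mapping.single (m + n) (Poly_Mapping.lookup p m * Poly_Mapping.lookup q n) +
      Poly_Mapping.single m (Poly_Mapping.lookup p m) * q' + p' * q"
    by (simp add: p'_def q'_def algebra_simps mult_single)
  moreover have "m + n \<notin> Poly_Mapping.keys (Poly_Mapping.single m (Poly_Mapping.lookup p m) * q')"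
    using keys_mult[of "Poly_Mapping.single m (Poly_Mapping.lookup p m)" q'] q'
    by (fastforce split: if_splits)
  moreover have "m + n \<notin> Poly_Mapping.keys (p' * q)"
  proof
    assume "m + n \<in> Poly_Mapping.keys (p' * q)"
    then obtain a b where "m + n = a + b" "a \<in> Poly_Mapping.keys p'" "b \<in> Poly_Mapping.keys q"
      using keys_mult[of p' q] by blast
    then show False using add_less_le_mono[OF p' q, of a b] by simp
  qed
  ultimately show ?thesis by (simp add: lookup_add in_keys_iff)
qed

lemma exponent_le_0:
  fixes m :: "nat \<Rightarrow>\<^sub>0 nat"
  assumes "m \<le> 0"
  shows "m = 0"
proof (rule ccontr)
  assume "m \<noteq> 0"
  with assms have "m < 0" by simp
  then show False by (auto simp: less_poly_mapping.rep_eq less_fun_def)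
qed

lemma domain_integral:
  assumes "domain (ring_of_type_algebra :: 'a::comm_ring_1 ring)" "(a::'a) * b = 0"
  shows "a = 0 \<or> b = 0"
  using domain.integral[OF assms(1), of a b] assms(2) by (simp add: ring_of_type_algebra_def)

lemma domain_mult_eq_1_const:
  fixes p q :: "'a::comm_ring_1 mpoly"
  assumes dom: "domain (ring_of_type_algebra :: 'a ring)" and pq: "p * q = 1"
  shows "\<exists>c. p = mconst c"
proof -
  let ?m = "Max (Poly_Mapping.keys p)" and ?n = "Max (Poly_Mapping.keys q)"
  have "p \<noteq> 0" "q \<noteq> 0" using pq by auto
  then have "?m \<in> Poly_Mapping.keys p" "?n \<in> Poly_Mapping.keys q" by (auto intro!: Max_in)
  then have "Poly_Mapping.lookup p ?m \<noteq> 0" "Poly_Mapping.lookup q ?n \<noteq> 0"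
    by (simp_all add: in_keys_iff)
  then have "Poly_Mapping.lookup p ?m * Poly_Mapping.lookup q ?n \<noteq> 0"
    using domain_integral[OF dom] by blast
  then have "Poly_Mapping.lookup (1::'a mpoly) (?m + ?n) \<noteq> 0"
    unfolding pq[symmetric] by (subst lookup_mult_top) simp_all
  then have "?m + ?n = 0" by (simp add: lookup_one when_def split: if_splits)
  then have m: "?m = 0"
    by (simp add: poly_mapping_eq_iff lookup_add fun_eq_iff)
  have "k = 0" if "k \<in> Poly_Mapping.keys p" for k
    using exponent_le_0 Max_ge[OF _ that] m by auto
  then have "p = mconst (Poly_Mapping.lookup p 0)"
    by (intro poly_mapping_eqI) (auto simp: mconst_def lookup_single when_def in_keys_iff)
  then show ?thesis by blast
qed

lemma mconst_eq_iff: "mconst a = mconst b \<longleftrightarrow> a = b"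
  unfolding mconst_def by (rule inj_eq[OF inj_single])

lemma Units_ring_of_type:
  "u \<in> Units (ring_of_type_algebra :: 'a::comm_ring_1 ring) \<longleftrightarrow> (\<exists>v. u * v = 1)"
  by (auto simp: Units_def ring_of_type_algebra_def mult.commute)

lemma domain_Units_mpoly_ring:
  assumes "domain (ring_of_type_algebra :: 'a::comm_ring_1 ring)"
  shows "Units (mpoly_ring k) = mconst ` Units (ring_of_type_algebra :: 'a ring)"
proof
  show "Units (mpoly_ring k) \<subseteq> mconst ` Units (ring_of_type_algebra :: 'a ring)"
  proof
    fix p :: "'a mpoly" assume "p \<in> Units (mpoly_ring k)"
    then obtain q where pq: "p * q = 1" by (auto simp: Units_mpoly_ring)
    then have "q * p = 1" by (simp add: mult.commute)
    with pq obtain c d where cd: "p = mconst c" "q = mconst d"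
      using domain_mult_eq_1_const[OF assms] by metis
    with pq have "c * d = 1"
      unfolding mconst_1[symmetric] mconst_mult[symmetric] cd by (simp only: mconst_eq_iff)
    then have "c \<in> Units (ring_of_type_algebra :: 'a ring)"
      by (auto simp: Units_ring_of_type)
    with cd show "p \<in> mconst ` Units (ring_of_type_algebra :: 'a ring)" by blast
  qed
  show "mconst ` Units (ring_of_type_algebra :: 'a ring) \<subseteq> Units (mpoly_ring k)"
  proof
    fix p assume "p \<in> mconst ` Units (ring_of_type_algebra :: 'a ring)"
    then obtain c d where "p = mconst c" "c * d = 1" by (auto simp: Units_ring_of_type)
    then show "p \<in> Units (mpoly_ring k)"
      by (intro Units_mpoly_ringI[of _ _ "mconst d"]) (simp_all add: mconst_closed mconst_mult[symmetric])
  qed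
qed

lemma coeff_mult_top:
  fixes p q :: "'a::comm_ring_1 poly"
  assumes "degree p \<le> m" "degree q \<le> n"
  shows "coeff (p * q) (m + n) = coeff p m * coeff q n"
proof (cases "degree p = m \<and> degree q = n")
  case True
  then show ?thesis using coeff_mult_degree_sum[of p q] by simp
next
  case False
  then have "degree p < m \<or> degree q < n" "degree (p * q) < m + n"
    using assms degree_mult_le[of p q] by linarith+
  then show ?thesis by (auto simp: coeff_eq_0)
qed

lemma coeff_pcompose_top:
  fixes p q :: "'a::comm_ring_1 poly"
  assumes "degree q > 0"
  shows "coeff (pcompose p q) (degree p * degree q) = lead_coeff p * lead_coeff q ^ degree p"
proof (induction p)
  case (pCons a p)
  show ?case
  proof (cases "p = 0")
    case False
    have "coeff (pcompose (pCons a p) q) (degree q + degree p * degree q) =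
      coeff (q * pcompose p q) (degree q + degree p * degree q)"
      using assms by (simp add: pcompose_pCons coeff_pCons split: nat.splits)
    also have "\<dots> = lead_coeff q * (lead_coeff p * lead_coeff q ^ degree p)"
      using degree_pcompose_le[of p q] by (subst coeff_mult_top) (simp_all add: pCons.IH)
    finally show ?thesis using False by (simp add: algebra_simps)
  qed simp
qed simp

lemma domain_Aut_Rx_affine:
  assumes dom: "domain (ring_of_type_algebra :: 'a::comm_ring_1 ring)"
    and "p \<in> carrier (Aut_Rx :: 'a poly monoid)"
  shows "\<exists>u f. u \<in> Units ring_of_type_algebra \<and> p = [:f, u:]"
proof -
  obtain q where pq: "pcompose p q = [:0, 1:]"
    using assms(2) by (auto simp: carrier_Aut_Rx)
  have q: "degree q > 0"
  proof (rule ccontr)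
    assume "\<not> degree q > 0"
    then have "degree (pcompose p q) \<le> 0" using degree_pcompose_le[of p q] by simp
    then show False using pq by simp
  qed
  have "degree p \<noteq> 0"
  proof
    assume "degree p = 0"
    then have "degree (pcompose p q) \<le> 0" using degree_pcompose_le[of p q] by simp
    then show False using pq by simp
  qed
  then have "p \<noteq> 0" "q \<noteq> 0" using q by auto
  have "a ^ k \<noteq> 0" if "a \<noteq> 0" for a :: 'a and k
    using that by (induction k) (auto dest: domain_integral[OF dom])
  then have "lead_coeff p * lead_coeff q ^ degree p \<noteq> 0"
    using \<open>p \<noteq> 0\<close> \<open>q \<noteq> 0\<close> domain_integral[OF dom] leading_coeff_neq_0 by metis
  then have "coeff [:0, 1::'a:] (degree p * degree q) \<noteq> 0"
    using coeff_pcompose_top[OF q, of p] pq by simp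
  then have "degree p * degree q = 1"
    by (auto simp: coeff_pCons split: nat.splits)
  then have deg: "degree p = 1" "degree q = 1" by simp_all
  then have "coeff p 1 * coeff q 1 = 1"
    using coeff_pcompose_top[OF q, of p] pq by simp
  moreover have "p = [:coeff p 0, coeff p 1:]"
    using deg(1) by (intro poly_eqI) (auto simp: coeff_pCons coeff_eq_0 split: nat.splits)
  ultimately show ?thesis by (auto simp: Units_ring_of_type)
qed

lemma Aff_base_simps [simp]:
  "carrier Aff_base = Units ring_of_type_algebra \<times> UNIV"
  "monoid.mult Aff_base (u, f) (v, g) = (u * v, f + u * g)"
  by (simp_all add: Aff_base_def semidirect_left_def units_of_def ring_of_type_algebra_def)

lemma Aff_const_group_simps [simp]:
  "carrier (Aff_const_group k) = Units ring_of_type_algebra \<times> carrier (mpoly_ring (k - 1))"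
  "monoid.mult (Aff_const_group k) (u, f) (v, g) = (u * v, f + mconst u * g)"
  by (simp_all add: Aff_const_group_def semidirect_left_def units_of_def)
     (simp add: ring_of_type_algebra_def)

lemma Units_ring_of_type_mult:
  "u \<in> Units (ring_of_type_algebra :: 'a::comm_ring_1 ring) \<Longrightarrow> v \<in> Units (ring_of_type_algebra :: 'a ring)
    \<Longrightarrow> u * v \<in> Units (ring_of_type_algebra :: 'a ring)"
  unfolding Units_ring_of_type by (metis mult.assoc mult.left_commute mult_1_right)

lemma mconst_affine_eq_iff:
  "mconst f + mvar 1 * mconst u = mconst g + mvar 1 * mconst v \<longleftrightarrow> f = g \<and> u = v"
  by (subst affine_eq_iff[of _ 0]) (simp_all add: mconst_closed mconst_eq_iff)

lemma domain_comp_units: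
  assumes dom: "domain (ring_of_type_algebra :: 'a::comm_ring_1 ring)"
  shows "comp_units = (\<lambda>(u::'a, f). mconst f + mvar 1 * mconst u) ` carrier Aff_base" (is "_ = ?R")
proof
  show "comp_units \<subseteq> ?R"
  proof
    fix P :: "'a mpoly" assume "P \<in> comp_units"
    then obtain p where p: "p \<in> carrier Aut_Rx" "P = poly_to_mpoly p"
      unfolding comp_units_eq_image by blast
    obtain u f where "u \<in> Units (ring_of_type_algebra :: 'a ring)" "p = [:f, u:]"
      using domain_Aut_Rx_affine[OF dom p(1)] by blast
    moreover from this have "P = mconst f + mvar 1 * mconst u"
      by (simp add: p(2) poly_to_mpoly_pCons)
    ultimately show "P \<in> ?R" by (intro image_eqI[of _ _ "(u, f)"]) simp_all
  qed
  show "?R \<subseteq> comp_units"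
  proof
    fix P assume "P \<in> ?R"
    then obtain u f where P: "P = mconst f + mvar 1 * mconst u" "u \<in> Units (ring_of_type_algebra :: 'a ring)"
      by auto
    then obtain v where v: "u * v = 1" by (auto simp: Units_ring_of_type)
    define g where "g = - (f * v)"
    have "f + u * g = f * (1 - u * v)" by (simp add: g_def algebra_simps)
    then have fg: "f + u * g = 0" "g + f * v = 0" by (simp_all add: v g_def)
    define Q where "Q = mconst g + mvar 1 * mconst v"
    have "msubst (\<lambda>_. Q) P = mconst (f + u * g) + mvar 1 * mconst (u * v)"
      "msubst (\<lambda>_. P) Q = mconst (g + f * v) + mvar 1 * mconst (u * v)"
      by (simp_all add: P(1) Q_def mconst_add mconst_mult algebra_simps)
    then have "msubst (\<lambda>_. Q) P = mvar 1" "msubst (\<lambda>_. P) Q = mvar 1"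
      by (simp_all only: fg v mconst_0 mconst_1 add_0_left mult_1_right)
    moreover have "P \<in> carrier (mpoly_ring 1)" "Q \<in> carrier (mpoly_ring 1)"
      by (auto simp: P(1) Q_def intro!: mpoly_closed)
    ultimately show "P \<in> comp_units" unfolding comp_units_def by blast
  qed
qed

lemma Aff_base_iso_TR_1:
  assumes dom: "domain (ring_of_type_algebra :: 'a::comm_ring_1 ring)"
  shows "(\<lambda>a. \<lambda>i\<in>{1..1}. (\<lambda>(u::'a, f). mconst f + mvar 1 * mconst u) a) \<in> iso Aff_base (TR 1)"
proof -
  let ?b = "\<lambda>(u::'a, f). mconst f + mvar 1 * mconst u"
  let ?h = "\<lambda>a. \<lambda>i\<in>{1..1::nat}. ?b a"
  have "inj_on ?h (carrier Aff_base)"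
  proof (rule inj_onI)
    fix x y assume eq: "?h x = ?h y"
    have "?b x = ?b y" using fun_cong[OF eq, of 1] by simp
    then show "x = y" by (cases x; cases y) (simp only: mconst_affine_eq_iff prod.case)
  qed
  moreover have "?h ` carrier Aff_base = carrier (TR 1)"
    unfolding carrier_TR[OF order_refl] Tri_1 domain_comp_units[OF dom] image_image ..
  moreover have "?h (x \<otimes>\<^bsub>Aff_base\<^esub> y) = tuple_comp 1 (?h x) (?h y)" for x y
  proof -
    obtain u f v g where xy: "x = (u, f)" "y = (v, g)" by fastforce
    have "?b x \<in> carrier (mpoly_ring 1)" unfolding xy(1) by (auto intro!: mpoly_closed)
    then have "tuple_comp 1 (?h x) (?h y) = (\<lambda>i\<in>{1..1}. msubst (\<lambda>_. ?b y) (?b x))"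
      by (rule tuple_comp_1)
    also have "msubst (\<lambda>_. ?b y) (?b x) = ?b (x \<otimes>\<^bsub>Aff_base\<^esub> y)"
      by (simp add: xy mconst_add mconst_mult algebra_simps)
    finally show ?thesis ..
  qed
  ultimately show ?thesis
    unfolding iso_iff hom_def TR_simps by blast
qed

lemma Aff_const_iso_Aff_group:
  assumes dom: "domain (ring_of_type_algebra :: 'a::comm_ring_1 ring)"
  shows "(\<lambda>(v::'a, g). (mconst v, g)) \<in> iso (Aff_const_group k) (Aff_group k)"
  unfolding iso_iff hom_def
  by (auto simp: domain_Units_mpoly_ring[OF dom] mconst_mult mconst_eq_iff image_iff inj_on_def)

lemma Aff_base_eq:
  "Aff_base = semidirect_left (units_of ring_of_type_algebra) (add_monoid ring_of_type_algebra)
     (\<otimes>\<^bsub>ring_of_type_algebra\<^esub>)"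
  by (simp add: Aff_base_def ring_of_type_algebra_def)

lemma domain_solvable_TR:
  assumes dom: "domain (ring_of_type_algebra :: 'a::comm_ring_1 ring)" and "n \<ge> 1"
  shows "solvable (TR n :: 'a mtuple monoid)"
proof -
  have "group (Aff_base :: ('a \<times> 'a) monoid)" "solvable (Aff_base :: ('a \<times> 'a) monoid)"
    unfolding Aff_base_eq using domain.axioms(1)[OF dom] by (rule affine_group_solvable)+
  then show ?thesis
    using iso_imp_solvable_iff[OF Aff_base_iso_TR_1[OF dom]] group_TR[OF order_refl]
      solvable_TR_iff_TR_1[OF \<open>n \<ge> 1\<close>] by blast
qed

lemma domain_TR_iso_Aff_const_product:
  assumes dom: "domain (ring_of_type_algebra :: 'a::comm_ring_1 ring)" and "n \<ge> 1"
  shows "(TR n :: 'a mtuple monoid) \<cong>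
    (Aff_const_product n :: ('a \<times> 'a, 'a \<times> 'a mpoly) nested monoid)"
  unfolding Aff_const_product_def
  using Aff_base_iso_TR_1[OF dom] _ Aff_const_iso_Aff_group[OF dom] _ _ _ \<open>n \<ge> 1\<close>
proof (rule TR_iso_iter_semidirect)
  show "x \<otimes>\<^bsub>Aff_base\<^esub> y \<in> carrier Aff_base"
    if "x \<in> carrier Aff_base" "y \<in> carrier Aff_base" for x y :: "'a \<times> 'a"
    using that by (cases x; cases y) (auto simp: Units_ring_of_type_mult)
  show "x \<otimes>\<^bsub>Aff_const_group k\<^esub> y \<in> carrier (Aff_const_group k)"
    if "x \<in> carrier (Aff_const_group k)" "y \<in> carrier (Aff_const_group k)"
    for x y :: "'a \<times> 'a mpoly" and k
    using that by (cases x; cases y) (auto simp: Units_ring_of_type_mult intro!: mpoly_closed)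
qed (auto simp: Aff_const_act_def Let_def msubst_Tri_closed)

theorem theorem4p10:
  fixes n :: nat
  assumes "n > 1"
  shows "(TR n :: 'a::comm_ring_1 mtuple monoid) \<cong> (Lin_product n :: ('a poly, 'a mtuple) nested monoid)
    \<and> (TR n :: 'a mtuple monoid) \<cong> (Aff_product n :: ('a poly, 'a mpoly \<times> 'a mpoly) nested monoid)
    \<and> (solvable (TR n :: 'a mtuple monoid) \<longleftrightarrow> solvable (Aut_Rx :: 'a poly monoid))
    \<and> (domain (ring_of_type_algebra :: 'a ring) \<longrightarrow>
         solvable (TR n :: 'a mtuple monoid) \<and>
         (TR n :: 'a mtuple monoid) \<cong> (Aff_const_product n :: ('a \<times> 'a, 'a \<times> 'a mpoly) nested monoid))"
proof -
  have "n \<ge> 1" using assms by simp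
  then show ?thesis
    using TR_iso_Lin_product TR_iso_Aff_product solvable_TR_iff domain_solvable_TR
      domain_TR_iso_Aff_const_product by blast
qed

end
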